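(* Consider an $s$-stage EPIRK-$K$ method with given coefficients and with Krylov-subspace dimension $M\ge1$ (defined in the context). Then the numerical solution $y_{n+1}$ has a B-series expansion over the trees $TK(M)$: there is a map $\mathsf{a}:TK(M)\to\mathbb{R}$, depending only on the method coefficients and $M$, such that for every $N$, every smooth $f:\mathbb{R}^N\to\mathbb{R}^N$, every $y_n\in\mathbb{R}^N$ and every $K\ge1$, $$y_{n+1}=y_n+\sum_{\tau\in TK(M),\ |\tau|\le K}\mathsf{a}(\tau)\,\frac{h^{|\tau|}}{\sigma(\tau)}\,F(\tau)(y_n)+O(h^{K+1})\qquad(h\to0),$$ where in $F(\tau)$ fat nodes correspond to the Krylov approximation $\mathbf{A}_n$ of the Jacobian.
   Context: **Method.** Let $f:\mathbb{R}^N\to\mathbb{R}^N$ be smooth, $y_n\in\mathbb{R}^N$, $\mathbf{J}_n=f'(y_n)$, $f_n=f(y_n)$. Let $\mathcal{K}_M=\mathrm{span}\{f_n,\mathbf{J}_nf_n,\dots,\mathbf{J}_n^{M-1}f_n\}$, let the columns of $\mathbf{V}$ be an orthonormal basis of $\mathcal{K}_M$, $\mathbf{H}=\mathbf{V}^T\mathbf{J}_n\mathbf{V}$, $\mathbf{A}_n=\mathbf{V}\mathbf{H}\mathbf{V}^T$. Let $\varphi_k(z)=\sum_{i\ge0}\frac{z^i}{(i+k)!}$, $\psi_j(z)=\sum_{k=1}^jp_{j,k}\varphi_k(z)$, $r(y)=f(y)-f(y_n)-\mathbf{A}_n(y-y_n)$. With $Y_0=y_n$, $\Delta^{(1)}r(Y_i)=r(Y_{i+1})-r(Y_i)$,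 $\Delta^{(j)}r(Y_i)=\Delta^{(j-1)}r(Y_{i+1})-\Delta^{(j-1)}r(Y_i)$, $\Delta^{(j)}r(y_n)=\Delta^{(j)}r(Y_0)$. The $s$-stage EPIRK-$K$ method with real coefficients $a_{i,j},b_j,g_{i,j},p_{j,k}$ is $$Y_i=y_n+a_{i,1}\psi_1(g_{i,1}h\mathbf{A}_n)hf(y_n)+\sum_{j=2}^ia_{i,j}\psi_j(g_{i,j}h\mathbf{A}_n)h\Delta^{(j-1)}r(y_n),\quad i=1,\dots,s-1,$$ $$y_{n+1}=y_n+b_1\psi_1(g_{s,1}h\mathbf{A}_n)hf(y_n)+\sum_{j=2}^sb_j\psi_j(g_{s,j}h\mathbf{A}_n)h\Delta^{(j-1)}r(y_n).$$ **Trees.** A $TW$-tree is a (non-empty, unordered) rooted tree with each node coloured meagre (full) or fat (empty), such that end vertices (leaves) are meagre and every fat vertex has exactly one child. $|\tau|$ is the number of nodes and $\sigma(\tau)$ the order of the symmetry (automorphism) group of $\tau$. Elementary differentials are defined recursively: if the root of $\tau$ is meagre with child subtrees $\tau_1,\dots,\tau_m$ ($m\ge0$), $F(\tau)(y)=f^{(m)}(y)\big(F(\tau_1)(y),\dots,F(\tau_m)(y)\big)$; if the root is fat with child subtree $\tau_1$, $F(\tau)(y)=\mathbf{A}_n F(\tau_1)(y)$. A sub-tree of $\tau$ is the tree formed by a vertex of $\tau$ and all its descendants; a tree is linear if each node has at most one child. $TK(k)$ is the set of $TW$-trees in which no linear sub-tree of order (number of nodes) less than or equal to $k$ has a fat root.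 *)

theory Defs
  imports
    "HOL-Analysis.Analysis"
    "HOL-Analysis.Finite_Function_Topology"
    "HOL-Library.Multiset"
    "HOL-Library.Landau_Symbols"
begin

text \<open>
  The datatype contains exactly the TW-trees: children form a multiset, so trees are unordered;
  a fat node has exactly one child, so every leaf is meagre.
\<close>

datatype tw_tree = Meagre "tw_tree multiset" | is_fat: Fat tw_tree

primrec children :: "tw_tree \<Rightarrow> tw_tree multiset" where
  "children (Meagre ts) = ts"
| "children (Fat t) = {#t#}"

primrec tree_order :: "tw_tree \<Rightarrow> nat" where
  "tree_order (Meagre ts) = Suc (sum_mset (image_mset tree_order ts))"
| "tree_order (Fat t) = Suc (tree_order t)"

text \<open>
  A concrete vertex set for a tree: a vertex is the path leading to it from the root. One step of
  a path names the child sub-tree \<open>t\<close> that is entered and, as \<open>t\<close> may occur several times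
  among the children, the number \<open>i\<close> of its copy. The root is the empty path and
  the parent of a vertex \<open>v \<noteq> []\<close> is \<open>butlast v\<close>.
\<close>

type_synonym vertex = "(tw_tree \<times> nat) list"

fun is_vertex :: "tw_tree \<Rightarrow> vertex \<Rightarrow> bool" where
  "is_vertex \<tau> [] \<longleftrightarrow> True"
| "is_vertex \<tau> ((t, i) # p) \<longleftrightarrow> i < count (children \<tau>) t \<and> is_vertex t p"

definition vertices :: "tw_tree \<Rightarrow> vertex set" where
  "vertices \<tau> = {v. is_vertex \<tau> v}"

fun subtree_at :: "tw_tree \<Rightarrow> vertex \<Rightarrow> tw_tree" where
  "subtree_at \<tau> [] = \<tau>"
| "subtree_at \<tau> ((t, i) # p) = subtree_at t p"

definition subtrees :: "tw_tree \<Rightarrow> tw_tree set" where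
  "subtrees \<tau> = subtree_at \<tau> ` vertices \<tau>"

definition automorphisms :: "tw_tree \<Rightarrow> (vertex \<Rightarrow> vertex) set" where
  "automorphisms \<tau> =
     {\<pi>. \<pi> permutes vertices \<tau> \<and> \<pi> [] = [] \<and>
         (\<forall>v\<in>vertices \<tau>. v \<noteq> [] \<longrightarrow> butlast (\<pi> v) = \<pi> (butlast v)) \<and>
         (\<forall>v\<in>vertices \<tau>. is_fat (subtree_at \<tau> (\<pi> v)) \<longleftrightarrow> is_fat (subtree_at \<tau> v))}"

definition symmetry :: "tw_tree \<Rightarrow> nat" where
  "symmetry \<tau> = card (automorphisms \<tau>)"

definition linear_tree :: "tw_tree \<Rightarrow> bool" where
  "linear_tree \<tau> \<longleftrightarrow> (\<forall>u\<in>subtrees \<tau>. size (children u) \<le> 1)"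

definition TK :: "nat \<Rightarrow> tw_tree set" where
  "TK k = {\<tau>. \<forall>u\<in>subtrees \<tau>. linear_tree u \<and> tree_order u \<le> k \<longrightarrow> \<not> is_fat u}"

text \<open>
  To quantify over the dimension inside a formula, all spaces \<open>\<real>\<^sup>N\<close> are
  realised inside one type, the finitely supported real sequences: \<open>Rn N\<close> consists of those
  with support in \<open>{..<N}\<close>. The library norm on this type is the sum norm; on \<open>Rn N\<close> it is
  equivalent to the Euclidean norm, so limits, derivatives and order symbols are the usual ones.
  Orthogonality refers to the standard inner product \<open>dot\<close>.
\<close>

type_synonym rvec = "nat \<Rightarrow>\<^sub>0 real"

definition Rn :: "nat \<Rightarrow> rvec set" where
  "Rn N = {x. Poly_Mapping.keys x \<subseteq> {..<N}}"

definition dot :: "rvec \<Rightarrow> rvec \<Rightarrow> real" where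
  "dot x y = (\<Sum>i\<in>Poly_Mapping.keys x. Poly_Mapping.lookup x i * Poly_Mapping.lookup y i)"

definition orthonormal :: "rvec list \<Rightarrow> bool" where
  "orthonormal vs \<longleftrightarrow>
     (\<forall>i<length vs. \<forall>j<length vs. dot (vs ! i) (vs ! j) = (if i = j then 1 else 0))"

text \<open>
  Functions \<open>f : S \<rightarrow> S\<close> on a linear subspace \<open>S\<close> (here \<open>Rn N\<close>) are represented by total
  functions whose values outside \<open>S\<close> play no role. Accordingly all derivatives are taken within
  \<open>S\<close> and applied to vectors of \<open>S\<close> only, where they are uniquely determined.
\<close>

definition deriv_on :: "'a::real_normed_vector set \<Rightarrow> ('a \<Rightarrow> 'a) \<Rightarrow> 'a \<Rightarrow> 'a \<Rightarrow> 'a" where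
  "deriv_on S f y = frechet_derivative f (at y within S)"

text \<open>\<open>C_on k S f\<close>: \<open>f\<close> is \<open>k\<close> times continuously differentiable on \<open>S\<close>.\<close>

primrec C_on :: "nat \<Rightarrow> 'a::real_normed_vector set \<Rightarrow> ('a \<Rightarrow> 'a) \<Rightarrow> bool" where
  "C_on 0 S f \<longleftrightarrow> continuous_on S f"
| "C_on (Suc k) S f \<longleftrightarrow>
     f differentiable_on S \<and> (\<forall>v\<in>S. C_on k S (\<lambda>y. deriv_on S f y v))"

definition smooth_on :: "'a::real_normed_vector set \<Rightarrow> ('a \<Rightarrow> 'a) \<Rightarrow> bool" where
  "smooth_on S f \<longleftrightarrow> (\<forall>k. C_on k S f)"

text \<open>\<open>nderiv S f [v\<^sub>1, \<dots>, v\<^sub>m] y\<close> is \<open>f\<^sup>(\<^sup>m\<^sup>)(y)(v\<^sub>1, \<dots>, v\<^sub>m)\<close>.\<close>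

primrec nderiv ::
  "'a::real_normed_vector set \<Rightarrow> ('a \<Rightarrow> 'a) \<Rightarrow> 'a list \<Rightarrow> 'a \<Rightarrow> 'a" where
  "nderiv S f [] = f"
| "nderiv S f (v # vs) = (\<lambda>y. deriv_on S (nderiv S f vs) y v)"

text \<open>
  For smooth \<open>f\<close> the derivative is symmetric in its arguments, so the enumeration of
  the children chosen by \<open>SOME\<close> is irrelevant. \<open>A\<close> is the operator attached to fat nodes.
\<close>

primrec elem_diff ::
  "'a::real_normed_vector set \<Rightarrow> ('a \<Rightarrow> 'a) \<Rightarrow> ('a \<Rightarrow> 'a) \<Rightarrow> 'a \<Rightarrow> tw_tree \<Rightarrow> 'a" where
  "elem_diff S f A y (Meagre ts) =
     nderiv S f (SOME vs. mset vs = image_mset (elem_diff S f A y) ts) y"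
| "elem_diff S f A y (Fat t) = A (elem_diff S f A y t)"

definition krylov_space ::
  "'a::real_normed_vector set \<Rightarrow> ('a \<Rightarrow> 'a) \<Rightarrow> nat \<Rightarrow> 'a \<Rightarrow> 'a set" where
  "krylov_space S f M y = span ((\<lambda>i. (deriv_on S f y ^^ i) (f y)) ` {..<M})"

text \<open>
  \<open>V H V\<^sup>T x\<close>, where \<open>V\<close> has the columns \<open>vs\<close> and \<open>H = V\<^sup>T J V\<close>, that is,
  \<open>H\<^sub>i\<^sub>j = v\<^sub>i \<bullet> J v\<^sub>j\<close>.
\<close>

definition krylov_approx :: "rvec list \<Rightarrow> (rvec \<Rightarrow> rvec) \<Rightarrow> rvec \<Rightarrow> rvec" where
  "krylov_approx vs J x =
     (\<Sum>i<length vs. (\<Sum>j<length vs. dot (vs ! i) (J (vs ! j)) * dot (vs ! j) x) *\<^sub>R vs ! i)"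

text \<open>
  The fields hold \<open>s\<close>, \<open>a\<^sub>i\<^sub>,\<^sub>j\<close>, \<open>b\<^sub>j\<close>, \<open>g\<^sub>i\<^sub>,\<^sub>j\<close>, \<open>p\<^sub>j\<^sub>,\<^sub>k\<close>, with indices starting from 1.
\<close>

record epirk =
  stages :: nat
  coef_a :: "nat \<Rightarrow> nat \<Rightarrow> real"
  coef_b :: "nat \<Rightarrow> real"
  coef_g :: "nat \<Rightarrow> nat \<Rightarrow> real"
  coef_p :: "nat \<Rightarrow> nat \<Rightarrow> real"

definition phi_fun :: "nat \<Rightarrow> ('a::real_normed_vector \<Rightarrow> 'a) \<Rightarrow> 'a \<Rightarrow> 'a" where
  "phi_fun k B x = suminf (\<lambda>i. (1 / fact (i + k)) *\<^sub>R (B ^^ i) x)"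

definition psi_fun :: "epirk \<Rightarrow> nat \<Rightarrow> ('a::real_normed_vector \<Rightarrow> 'a) \<Rightarrow> 'a \<Rightarrow> 'a" where
  "psi_fun C j B x = (\<Sum>k=1..j. coef_p C j k *\<^sub>R phi_fun k B x)"

text \<open>\<open>fdiff u j i\<close> is \<open>\<Delta>\<^sup>(\<^sup>j\<^sup>) u\<^sub>i\<close>.\<close>

primrec fdiff :: "(nat \<Rightarrow> 'a::ab_group_add) \<Rightarrow> nat \<Rightarrow> nat \<Rightarrow> 'a" where
  "fdiff u 0 = u"
| "fdiff u (Suc j) = (\<lambda>i. fdiff u j (Suc i) - fdiff u j i)"

lemma fdiff_cong [fundef_cong]:
  assumes "j = j'" "i = i'" "\<And>k. k \<le> i' + j' \<Longrightarrow> u k = u' k"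
  shows "fdiff u j i = fdiff u' j' i'"
proof -
  have "(\<And>k. k \<le> i + j \<Longrightarrow> u k = u' k) \<Longrightarrow> fdiff u j i = fdiff u' j i"
    by (induction j arbitrary: i) auto
  with assms show ?thesis by simp
qed

definition remainder :: "('a::ab_group_add \<Rightarrow> 'a) \<Rightarrow> ('a \<Rightarrow> 'a) \<Rightarrow> 'a \<Rightarrow> 'a \<Rightarrow> 'a" where
  "remainder f A y x = f x - f y - A (x - y)"

text \<open>\<open>stage C f A y h i\<close> is \<open>Y\<^sub>i\<close> for the starting value \<open>y\<close> and step size \<open>h\<close>.\<close>

fun stage ::
  "epirk \<Rightarrow> ('a::real_normed_vector \<Rightarrow> 'a) \<Rightarrow> ('a \<Rightarrow> 'a) \<Rightarrow> 'a \<Rightarrow> real \<Rightarrow> nat \<Rightarrow> 'a" where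
  "stage C f A y h 0 = y"
| "stage C f A y h (Suc i) =
     y + coef_a C (Suc i) 1 *\<^sub>R
           psi_fun C 1 (\<lambda>x. (coef_g C (Suc i) 1 * h) *\<^sub>R A x) (h *\<^sub>R f y)
       + (\<Sum>j=2..Suc i. coef_a C (Suc i) j *\<^sub>R
           psi_fun C j (\<lambda>x. (coef_g C (Suc i) j * h) *\<^sub>R A x)
             (h *\<^sub>R fdiff (\<lambda>k. remainder f A y (stage C f A y h k)) (j - 1) 0))"

definition epirk_step ::
  "epirk \<Rightarrow> ('a::real_normed_vector \<Rightarrow> 'a) \<Rightarrow> ('a \<Rightarrow> 'a) \<Rightarrow> 'a \<Rightarrow> real \<Rightarrow> 'a" where
  "epirk_step C f A y h =
     y + coef_b C 1 *\<^sub>R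
           psi_fun C 1 (\<lambda>x. (coef_g C (stages C) 1 * h) *\<^sub>R A x) (h *\<^sub>R f y)
       + (\<Sum>j=2..stages C. coef_b C j *\<^sub>R
           psi_fun C j (\<lambda>x. (coef_g C (stages C) j * h) *\<^sub>R A x)
             (h *\<^sub>R fdiff (\<lambda>k. remainder f A y (stage C f A y h k)) (j - 1) 0))"

end

theory Submission
  imports Defs
begin

text \<open>
  The coefficients \<open>a \<tau>\<close> may be rescaled by the positive numbers \<open>symmetry \<tau>\<close>
  (\<open>symmetry_pos\<close>), so it is enough that \<open>y\<^sub>n\<^sub>+\<^sub>1 - y\<^sub>n\<close> is, up to
  \<open>O(h\<^sup>K\<^sup>+\<^sup>1)\<close>, a linear combination of the vectors \<open>h\<^bsup>|\<tau>|\<^esup> F(\<tau>)\<close>,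
  \<open>\<tau> \<in> TK M\<close>, whose coefficients depend on the method and on \<open>M\<close> only. No formula for them is
  derived. Instead, for fixed \<open>K\<close>, the class of all \<open>h\<close>-dependent vectors with such an
  expansion (\<open>expands\<close>) is shown to be closed under every operation occurring in a
  step of the method.

  Single trees. \<open>h\<^bsup>|\<tau>|\<^esup> F(\<tau>)\<close> belongs to the class for every tree, not only for those in
  \<open>TK M\<close>. The operator \<open>A\<close> is the Jacobian \<open>J\<close> compressed to the Krylov space, so
  \<open>A J\<^sup>i f = J\<^sup>i\<^sup>+\<^sup>1 f\<close> as long as \<open>i + 1 < M\<close>. A linear sub-tree of order at most \<open>M\<close>
  therefore has the elementary differential of the tall meagre tree, whatever the colours of its
  nodes; recolouring all these sub-trees (\<open>reduce\<close>) leads into \<open>TK M\<close> and changes neither the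
  order nor the elementary differential (\<open>F_reduce\<close>).

  Operations. The class is closed under linear combinations and under adding terms of order
  \<open>K + 1\<close>. Applying \<open>h A\<close> puts a fat root on each tree, and \<open>\<phi>\<^sub>k(g h A)\<close> is a polynomial in
  \<open>h A\<close> up to order \<open>K + 1\<close> (\<open>expands_phi_fun\<close>). Passing from \<open>u\<close> to \<open>h f(y + u)\<close> is Taylor
  expansion followed by multilinear expansion of the derivatives; the products that arise are the
  elementary differentials of the trees with a meagre root (\<open>expands_vector_field\<close>). The order
  in which the children are enumerated is irrelevant since higher derivatives are symmetric
  (\<open>nderiv_mset_cong\<close>). Induction over the stages yields the expansion of
  \<open>y\<^sub>n\<^sub>+\<^sub>1 - y\<^sub>n\<close> for each \<open>K\<close>.

  One coefficient map for all \<open>K\<close>. The coefficients obtained so far may depend on \<open>K\<close>, as the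
  elementary differentials of different trees can be linearly dependent. But the vectors that are
  the coefficients of the powers of \<open>h\<close> in an asymptotic expansion are unique
  (\<open>polynomial_coefficients_vanish\<close>), so a tree of order \<open>k\<close> may be given the
  coefficient from the expansion with \<open>K = k\<close>.
\<close>

section \<open>Coordinates of finitely supported sequences\<close>

abbreviation coord :: "rvec \<Rightarrow> nat \<Rightarrow> real" where
  "coord \<equiv> Poly_Mapping.lookup"

lemma coord_scaleR [simp]: "coord (c *\<^sub>R x) i = c * coord x i"
proof -
  have "finite {n. c *\<^sub>R coord x n \<noteq> 0}"
    by (rule finite_subset[of _ "Poly_Mapping.keys x"]) (auto simp: in_keys_iff)
  then show ?thesis
    by (simp add: scaleR_poly_mapping_def Poly_Mapping.map.rep_eq when_def)
qed

lemma abs_coord_le_norm: "\<bar>coord x i\<bar> \<le> norm x"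
proof (cases "i \<in> Poly_Mapping.keys x")
  case True
  then have "\<bar>coord x i\<bar> \<le> (\<Sum>n\<in>Poly_Mapping.keys x. \<bar>coord x n\<bar>)"
    by (intro member_le_sum) auto
  then show ?thesis
    by (simp add: norm_poly_mapping_def dist_poly_mapping_def)
qed (simp add: in_keys_iff)

lemma bounded_linear_coord: "bounded_linear (\<lambda>x. coord x i)"
  by (rule bounded_linear_intro[of _ 1]) (simp_all add: lookup_add abs_coord_le_norm)

lemma subspace_Rn: "subspace (Rn N)"
  unfolding subspace_def Rn_def
  by (auto simp: in_keys_iff lookup_add subset_iff) (metis add.right_neutral add.left_neutral)

lemma coord_Rn: "x \<in> Rn N \<Longrightarrow> N \<le> i \<Longrightarrow> coord x i = 0"
  by (auto simp: Rn_def in_keys_iff)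

lemma Rn_I: "(\<And>i. N \<le> i \<Longrightarrow> coord x i = 0) \<Longrightarrow> x \<in> Rn N"
  by (auto simp: Rn_def in_keys_iff subset_iff) (meson not_le)

definition unit_vec :: "nat \<Rightarrow> rvec" where
  "unit_vec i = Poly_Mapping.single i 1"

lemma unit_vec_Rn: "i < N \<Longrightarrow> unit_vec i \<in> Rn N"
  by (auto simp: Rn_def unit_vec_def)

lemma norm_unit_vec: "norm (unit_vec i) = 1"
  by (simp add: norm_poly_mapping_def dist_poly_mapping_def unit_vec_def)

lemma Rn_basis_expansion:
  assumes "x \<in> Rn N"
  shows "x = (\<Sum>i<N. coord x i *\<^sub>R unit_vec i)"
proof (rule poly_mapping_eqI)
  fix k
  have "coord (\<Sum>i<N. coord x i *\<^sub>R unit_vec i) k = (\<Sum>i<N. if i = k then coord x i else 0)"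
    unfolding lookup_sum by (rule sum.cong) (auto simp: unit_vec_def lookup_single when_def)
  also have "\<dots> = coord x k"
    using coord_Rn[OF assms, of k] by (cases "k < N") auto
  finally show "coord x k = coord (\<Sum>i<N. coord x i *\<^sub>R unit_vec i) k" by simp
qed

lemma norm_le_sum_coord:
  assumes "x \<in> Rn N"
  shows "norm x \<le> (\<Sum>i<N. \<bar>coord x i\<bar>)"
proof -
  have "norm x = norm (\<Sum>i<N. coord x i *\<^sub>R unit_vec i)"
    using Rn_basis_expansion[OF assms] by simp
  also have "\<dots> \<le> (\<Sum>i<N. norm (coord x i *\<^sub>R unit_vec i))"
    by (rule norm_sum)
  finally show ?thesis by (simp add: norm_unit_vec)
qed

lemma norm_le_coord_bound:
  assumes "x \<in> Rn N" "\<And>i. i < N \<Longrightarrow> \<bar>coord x i\<bar> \<le> B"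
  shows "norm x \<le> real N * B"
proof -
  have "(\<Sum>i<N. \<bar>coord x i\<bar>) \<le> (\<Sum>i<N. B)"
    by (rule sum_mono) (use assms in auto)
  with norm_le_sum_coord[OF assms(1)] show ?thesis by simp
qed

section \<open>Derivatives within a subspace\<close>

lemma deriv_on_has_derivative:
  assumes "g differentiable_on S" "y \<in> S"
  shows "(g has_derivative deriv_on S g y) (at y within S)"
proof -
  have "deriv_on S g y = frechet_derivative g (at y within S)"
    by (simp add: deriv_on_def fun_eq_iff)
  then show ?thesis
    using assms by (simp add: differentiable_on_def frechet_derivative_works)
qed

lemma has_vector_derivative_along_line:
  assumes S: "subspace S" and g: "g differentiable_on S" and y: "y \<in> S" and v: "v \<in> S"
  shows "((\<lambda>t. g (y + t *\<^sub>R v)) has_vector_derivative deriv_on S g (y + t *\<^sub>R v) v) (at t)"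
proof -
  have mem: "y + s *\<^sub>R v \<in> S" for s
    using S y v by (simp add: subspace_add subspace_scale)
  have D: "(g has_derivative deriv_on S g (y + t *\<^sub>R v)) (at (y + t *\<^sub>R v) within S)"
    by (rule deriv_on_has_derivative[OF g mem])
  have "((\<lambda>t. y + t *\<^sub>R v) has_derivative (\<lambda>s. s *\<^sub>R v)) (at t)"
    by (auto intro!: derivative_eq_intros)
  then have "(g \<circ> (\<lambda>t. y + t *\<^sub>R v) has_derivative deriv_on S g (y + t *\<^sub>R v) \<circ> (\<lambda>s. s *\<^sub>R v)) (at t)"
    by (rule diff_chain_within) (rule has_derivative_subset[OF D], use mem in auto)
  moreover have "deriv_on S g (y + t *\<^sub>R v) (s *\<^sub>R v) = s *\<^sub>R deriv_on S g (y + t *\<^sub>R v) v" for s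
    using has_derivative_linear[OF D] by (rule linear_scale)
  ultimately show ?thesis
    by (simp add: has_vector_derivative_def o_def)
qed

text \<open>
  Directional derivatives determine the derivative within a subspace, although
  \<open>frechet_derivative\<close> itself is chosen arbitrarily off the subspace.
\<close>

lemma deriv_on_eqI:
  assumes "subspace S" "g differentiable_on S" "y \<in> S" "v \<in> S"
    and "((\<lambda>t. g (y + t *\<^sub>R v)) has_vector_derivative d) (at 0)"
  shows "deriv_on S g y v = d"
  using has_vector_derivative_along_line[OF assms(1-4), of 0] assms(5)
  by (auto dest: vector_derivative_unique_at)

lemma deriv_on_cong:
  assumes S: "subspace S" and g: "g differentiable_on S" and y: "y \<in> S" and v: "v \<in> S"
    and eq: "\<And>x. x \<in> S \<Longrightarrow> g x = k x"
  shows "deriv_on S k y v = deriv_on S g y v"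
proof (rule deriv_on_eqI[OF S _ y v])
  show "k differentiable_on S"
    using g unfolding differentiable_on_def differentiable_def
    by (metis eq has_derivative_transform)
  have "g (y + t *\<^sub>R v) = k (y + t *\<^sub>R v)" for t
    using S y v by (intro eq) (simp add: subspace_add subspace_scale)
  then show "((\<lambda>t. k (y + t *\<^sub>R v)) has_vector_derivative deriv_on S g y v) (at 0)"
    using has_vector_derivative_along_line[OF S g y v, of 0] by simp
qed

lemma deriv_on_linear_combination:
  assumes S: "subspace S" and y: "y \<in> S" and v: "v \<in> S"
    and g: "\<And>x. x \<in> X \<Longrightarrow> g x differentiable_on S"
  shows "deriv_on S (\<lambda>z. \<Sum>x\<in>X. c x *\<^sub>R g x z) y v = (\<Sum>x\<in>X. c x *\<^sub>R deriv_on S (g x) y v)"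
proof (rule deriv_on_eqI[OF S _ y v])
  have "(\<lambda>z. \<Sum>x\<in>X. c x *\<^sub>R g x z) differentiable at z within S" if "z \<in> S" for z
  proof (cases "finite X")
    case True
    then show ?thesis
      using g that by (auto intro!: differentiable_sum differentiable_scaleR simp: differentiable_on_def)
  qed simp
  then show "(\<lambda>z. \<Sum>x\<in>X. c x *\<^sub>R g x z) differentiable_on S"
    by (simp add: differentiable_on_def)
  have *: "((\<lambda>t. g x (y + t *\<^sub>R v)) has_vector_derivative deriv_on S (g x) y v) (at 0)" if "x \<in> X" for x
    using has_vector_derivative_along_line[OF S g[OF that] y v, of 0] by simp
  show "((\<lambda>t. \<Sum>x\<in>X. c x *\<^sub>R g x (y + t *\<^sub>R v)) has_vector_derivative
      (\<Sum>x\<in>X. c x *\<^sub>R deriv_on S (g x) y v)) (at 0)"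
    by (intro has_vector_derivative_sum has_vector_derivative_scaleR[where f' = 0, simplified]) (use * in auto)
qed

section \<open>Symmetry of higher derivatives\<close>

text \<open>
  Schwarz's theorem at the origin. By the mean value theorem, applied twice in either order, the
  second difference over the square with corners \<open>(0, 0)\<close> and \<open>(h, h)\<close> is \<open>h\<^sup>2\<close> times a
  value of each mixed derivative inside that square; continuity then identifies their limits.
\<close>

lemma mixed_partial_derivatives_commute:
  fixes \<phi> :: "real \<Rightarrow> real \<Rightarrow> real"
  assumes d1: "\<And>s t. ((\<lambda>s. \<phi> s t) has_real_derivative \<phi>s s t) (at s)"
    and d2: "\<And>s t. ((\<lambda>t. \<phi> s t) has_real_derivative \<phi>t s t) (at t)"
    and d12: "\<And>s t. ((\<lambda>t. \<phi>s s t) has_real_derivative \<phi>st s t) (at t)"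
    and d21: "\<And>s t. ((\<lambda>s. \<phi>t s t) has_real_derivative \<phi>ts s t) (at s)"
    and c12: "isCont (\<lambda>p. \<phi>st (fst p) (snd p)) (0, 0)"
    and c21: "isCont (\<lambda>p. \<phi>ts (fst p) (snd p)) (0, 0)"
  shows "\<phi>st 0 0 = \<phi>ts 0 0"
proof (rule ccontr)
  assume ne: "\<phi>st 0 0 \<noteq> \<phi>ts 0 0"
  define e where "e = \<bar>\<phi>st 0 0 - \<phi>ts 0 0\<bar> / 2"
  have "e > 0" using ne by (simp add: e_def)
  obtain d where d: "d > 0" "\<And>p. dist p (0, 0) < d \<Longrightarrow> dist (\<phi>st (fst p) (snd p)) (\<phi>st 0 0) < e"
    using c12 \<open>e > 0\<close> by (auto simp: continuous_at_eps_delta)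
  obtain d' where d': "d' > 0" "\<And>p. dist p (0, 0) < d' \<Longrightarrow> dist (\<phi>ts (fst p) (snd p)) (\<phi>ts 0 0) < e"
    using c21 \<open>e > 0\<close> by (auto simp: continuous_at_eps_delta)
  \<comment> \<open>half of the smaller radius: the square of side \<open>h\<close> lies in both balls\<close>
  define h where "h = min d d' / 2"
  have h: "h > 0" using d d' by (simp add: h_def)
  have near: "dist (s, t) (0, 0) < d \<and> dist (s, t) (0, 0) < d'" if "0 < s" "s < h" "0 < t" "t < h" for s t
  proof -
    have "dist (s, t) (0::real, 0::real) = norm (s, t)" by (simp add: dist_norm)
    also have "\<dots> \<le> norm s + norm t" by (rule norm_Pair_le)
    also have "\<dots> < 2 * h" using that by simp
    finally show ?thesis by (simp add: h_def)
  qed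
  have "\<exists>s. 0 < s \<and> s < h \<and> (\<phi> h h - \<phi> h 0) - (\<phi> 0 h - \<phi> 0 0) = (h - 0) * (\<phi>s s h - \<phi>s s 0)"
    by (rule MVT2[OF h]) (intro derivative_intros d1)
  then obtain s where s: "0 < s" "s < h" "(\<phi> h h - \<phi> h 0) - (\<phi> 0 h - \<phi> 0 0) = h * (\<phi>s s h - \<phi>s s 0)"
    by auto
  have "\<exists>t. 0 < t \<and> t < h \<and> \<phi>s s h - \<phi>s s 0 = (h - 0) * \<phi>st s t"
    by (rule MVT2[OF h]) (rule d12)
  then obtain t where t: "0 < t" "t < h" "\<phi>s s h - \<phi>s s 0 = h * \<phi>st s t" by auto
  have "\<exists>t. 0 < t \<and> t < h \<and> (\<phi> h h - \<phi> 0 h) - (\<phi> h 0 - \<phi> 0 0) = (h - 0) * (\<phi>t h t - \<phi>t 0 t)"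
    by (rule MVT2[OF h]) (intro derivative_intros d2)
  then obtain t' where t': "0 < t'" "t' < h" "(\<phi> h h - \<phi> 0 h) - (\<phi> h 0 - \<phi> 0 0) = h * (\<phi>t h t' - \<phi>t 0 t')"
    by auto
  have "\<exists>s. 0 < s \<and> s < h \<and> \<phi>t h t' - \<phi>t 0 t' = (h - 0) * \<phi>ts s t'"
    by (rule MVT2[OF h]) (rule d21)
  then obtain s' where s': "0 < s'" "s' < h" "\<phi>t h t' - \<phi>t 0 t' = h * \<phi>ts s' t'" by auto
  have "h * (h * \<phi>st s t) = h * (h * \<phi>ts s' t')"
    using s(3) t(3) t'(3) s'(3) by (simp add: algebra_simps)
  then have "\<phi>st s t = \<phi>ts s' t'" using h by simp
  moreover have "dist (\<phi>st s t) (\<phi>st 0 0) < e"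
    using d(2)[of "(s, t)"] near[OF s(1,2) t(1,2)] by simp
  moreover have "dist (\<phi>ts s' t') (\<phi>ts 0 0) < e"
    using d'(2)[of "(s', t')"] near[OF s'(1,2) t'(1,2)] by simp
  ultimately show False unfolding e_def dist_real_def by (auto simp: abs_if split: if_splits)
qed

lemma C_on_nderiv:
  assumes "smooth_on S f" "set vs \<subseteq> S"
  shows "C_on k S (nderiv S f vs)"
  using assms(2)
proof (induction vs arbitrary: k)
  case Nil
  then show ?case using assms(1) by (simp add: smooth_on_def)
next
  case (Cons v vs)
  from Cons.IH[of "Suc k"] Cons.prems show ?case by simp
qed

lemma nderiv_differentiable_on:
  assumes "smooth_on S f" "set vs \<subseteq> S"
  shows "nderiv S f vs differentiable_on S"
  using C_on_nderiv[OF assms, of "Suc 0"] by simp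

lemma nderiv_continuous_on:
  assumes "smooth_on S f" "set vs \<subseteq> S"
  shows "continuous_on S (nderiv S f vs)"
  using C_on_nderiv[OF assms, of 0] by simp

lemma coord_deriv_along_line:
  assumes "g differentiable_on Rn N" "y \<in> Rn N" "v \<in> Rn N"
  shows "((\<lambda>t. coord (g (y + t *\<^sub>R v)) i) has_real_derivative
           coord (deriv_on (Rn N) g (y + t *\<^sub>R v) v) i) (at t)"
  using bounded_linear.has_vector_derivative[OF bounded_linear_coord
      has_vector_derivative_along_line[OF subspace_Rn assms]]
  by (simp add: has_real_derivative_iff_has_vector_derivative)

text \<open>
  The coordinates beyond \<open>N\<close> vanish along every line in \<open>Rn N\<close>, hence so do their derivatives.
\<close>

lemma deriv_on_in_Rn:
  assumes "g differentiable_on Rn N" "y \<in> Rn N" "v \<in> Rn N" "g \<in> Rn N \<rightarrow> Rn N"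
  shows "deriv_on (Rn N) g y v \<in> Rn N"
proof (rule Rn_I)
  fix i assume "N \<le> i"
  have "g (y + t *\<^sub>R v) \<in> Rn N" for t
    using assms subspace_Rn by (intro funcset_mem[OF assms(4)]) (simp add: subspace_add subspace_scale)
  then have "coord (g (y + t *\<^sub>R v)) i = 0" for t
    using \<open>N \<le> i\<close> coord_Rn by blast
  then show "coord (deriv_on (Rn N) g y v) i = 0"
    using coord_deriv_along_line[OF assms(1-3), of i 0] DERIV_unique[OF _ DERIV_const] by simp
qed

locale smooth_vector_field =
  fixes N :: nat and f :: "rvec \<Rightarrow> rvec"
  assumes maps_Rn: "f \<in> Rn N \<rightarrow> Rn N" and smooth: "smooth_on (Rn N) f"
begin

lemma nderiv_in_Rn:
  assumes "set vs \<subseteq> Rn N"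
  shows "nderiv (Rn N) f vs \<in> Rn N \<rightarrow> Rn N"
  using assms
proof (induction vs)
  case Nil
  then show ?case using maps_Rn by simp
next
  case (Cons v vs)
  then show ?case
    using deriv_on_in_Rn[OF nderiv_differentiable_on[OF smooth, of vs]] by (auto simp: Pi_iff)
qed

text \<open>
  Each coordinate is Schwarz's theorem for the plane through \<open>z\<close> spanned by \<open>u\<close> and \<open>v\<close>.
\<close>

lemma nderiv_swap:
  assumes "set vs \<subseteq> Rn N" "u \<in> Rn N" "v \<in> Rn N" "z \<in> Rn N"
  shows "nderiv (Rn N) f (u # v # vs) z = nderiv (Rn N) f (v # u # vs) z"
proof (rule poly_mapping_eqI)
  fix i
  let ?p = "\<lambda>s t. z + s *\<^sub>R u + t *\<^sub>R v"
  let ?D = "\<lambda>ws s t. coord (nderiv (Rn N) f ws (?p s t)) i"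
  have mem: "z + s *\<^sub>R u + t *\<^sub>R v \<in> Rn N" "z + s *\<^sub>R u \<in> Rn N" "z + s *\<^sub>R v \<in> Rn N" for s t
    using assms subspace_Rn by (simp_all add: subspace_add subspace_scale)
  have D1: "((\<lambda>s. ?D ws s t) has_real_derivative ?D (u # ws) s t) (at s)" if "set ws \<subseteq> Rn N" for ws s t
    using coord_deriv_along_line[OF nderiv_differentiable_on[OF smooth that] mem(3)[of t] assms(2), of i s]
    by (simp add: add_ac)
  have D2: "((\<lambda>t. ?D ws s t) has_real_derivative ?D (v # ws) s t) (at t)" if "set ws \<subseteq> Rn N" for ws s t
    using coord_deriv_along_line[OF nderiv_differentiable_on[OF smooth that] mem(2)[of s] assms(3), of i t]
    by simp
  have cont: "isCont (\<lambda>p. ?D ws (fst p) (snd p)) (0, 0)" if "set ws \<subseteq> Rn N" for ws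
  proof -
    have "continuous_on UNIV (\<lambda>p. nderiv (Rn N) f ws (?p (fst p) (snd p)))"
      by (rule continuous_on_compose2[OF nderiv_continuous_on[OF smooth that]])
        (use mem in \<open>auto intro!: continuous_intros\<close>)
    then have "continuous_on UNIV (\<lambda>p. ?D ws (fst p) (snd p))"
      by (rule bounded_linear.continuous_on[OF bounded_linear_coord])
    then show ?thesis by (simp add: continuous_on_eq_continuous_at)
  qed
  have "?D (v # u # vs) 0 0 = ?D (u # v # vs) 0 0"
    by (rule mixed_partial_derivatives_commute[where \<phi> = "?D vs" and \<phi>s = "?D (u # vs)" and \<phi>t = "?D (v # vs)"])
      (use assms D1 D2 cont in \<open>auto simp del: nderiv.simps\<close>)
  then show "coord (nderiv (Rn N) f (u # v # vs) z) i = coord (nderiv (Rn N) f (v # u # vs) z) i"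
    by simp
qed

lemma nderiv_cong_tail:
  assumes "\<And>z. z \<in> Rn N \<Longrightarrow> nderiv (Rn N) f vs z = nderiv (Rn N) f ws z"
    and "set vs \<subseteq> Rn N" "v \<in> Rn N" "z \<in> Rn N"
  shows "nderiv (Rn N) f (v # vs) z = nderiv (Rn N) f (v # ws) z"
  using deriv_on_cong[OF subspace_Rn nderiv_differentiable_on[OF smooth assms(2)] assms(4,3), of "nderiv (Rn N) f ws"]
    assms(1) by simp

lemma nderiv_move_to_front:
  assumes "set us \<subseteq> Rn N" "set vs \<subseteq> Rn N" "v \<in> Rn N" "z \<in> Rn N"
  shows "nderiv (Rn N) f (us @ v # vs) z = nderiv (Rn N) f (v # us @ vs) z"
  using assms(1,4)
proof (induction us arbitrary: z)
  case (Cons u us)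
  have "nderiv (Rn N) f (u # us @ v # vs) z = nderiv (Rn N) f (u # v # us @ vs) z"
    by (rule nderiv_cong_tail) (use Cons assms in auto)
  also have "\<dots> = nderiv (Rn N) f (v # u # us @ vs) z"
    by (rule nderiv_swap) (use Cons assms in auto)
  finally show ?case by simp
qed simp

text \<open>
  Symmetry in all arguments: adjacent swaps generate every rearrangement.
\<close>

lemma nderiv_mset_cong:
  assumes "mset vs = mset ws" "set vs \<subseteq> Rn N" "z \<in> Rn N"
  shows "nderiv (Rn N) f vs z = nderiv (Rn N) f ws z"
  using assms
proof (induction vs arbitrary: ws z)
  case (Cons v vs)
  then have "v \<in> set ws" by (metis list.set_intros(1) mset_eq_setD)
  then obtain xs ys where ws: "ws = xs @ v # ys" by (meson split_list)
  have ms: "mset vs = mset (xs @ ys)" using Cons.prems(1) ws by simp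
  then have sub: "set (xs @ ys) \<subseteq> Rn N" using Cons.prems(2) by (metis mset_eq_setD set_subset_Cons subset_trans)
  have "nderiv (Rn N) f (v # vs) z = nderiv (Rn N) f (v # xs @ ys) z"
    by (rule nderiv_cong_tail) (use Cons ms in auto)
  also have "\<dots> = nderiv (Rn N) f ws z"
    unfolding ws by (rule nderiv_move_to_front[symmetric]) (use sub Cons.prems in auto)
  finally show ?case .
qed simp

end

section \<open>Multilinear expansion and Taylor approximation\<close>

context smooth_vector_field
begin

text \<open>
  Each factor of the \<open>m\<close>-fold product of the sum independently picks a summand, so the terms are
  indexed by the lists of length \<open>m\<close>.
\<close>

lemma nderiv_replicate_expansion:
  assumes X: "finite X" and v: "v ` X \<subseteq> Rn N" and z: "z \<in> Rn N"
  shows "nderiv (Rn N) f (replicate m (\<Sum>x\<in>X. c x *\<^sub>R v x)) z =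
    (\<Sum>xs | set xs \<subseteq> X \<and> length xs = m. prod_list (map c xs) *\<^sub>R nderiv (Rn N) f (map v xs) z)"
  using z
proof (induction m arbitrary: z)
  case 0
  have "{xs. set xs \<subseteq> X \<and> length xs = 0} = {[]}" by auto
  then show ?case by simp
next
  case (Suc m)
  let ?S = "Rn N"
  let ?T = "\<Sum>x\<in>X. c x *\<^sub>R v x"
  let ?L = "{xs. set xs \<subseteq> X \<and> length xs = m}"
  have T: "?T \<in> ?S"
    using v subspace_Rn by (intro subspace_sum subspace_scale) auto
  have diff: "nderiv ?S f (map v xs) differentiable_on ?S" if "xs \<in> ?L" for xs
    using that v by (intro nderiv_differentiable_on[OF smooth]) auto
  have "nderiv ?S f (replicate m ?T) differentiable_on ?S"
    using T by (intro nderiv_differentiable_on[OF smooth]) auto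
  from deriv_on_cong[OF subspace_Rn this Suc.prems T Suc.IH]
  have "nderiv ?S f (replicate (Suc m) ?T) z =
      deriv_on ?S (\<lambda>z. \<Sum>xs\<in>?L. prod_list (map c xs) *\<^sub>R nderiv ?S f (map v xs) z) z ?T"
    by simp
  also have "\<dots> = (\<Sum>xs\<in>?L. prod_list (map c xs) *\<^sub>R deriv_on ?S (nderiv ?S f (map v xs)) z ?T)"
    by (rule deriv_on_linear_combination[OF subspace_Rn Suc.prems T diff])
  also have "\<dots> = (\<Sum>xs\<in>?L. \<Sum>x\<in>X. prod_list (map c (x # xs)) *\<^sub>R nderiv ?S f (map v (x # xs)) z)"
  proof (rule sum.cong[OF refl])
    fix xs assume xs: "xs \<in> ?L"
    have "linear (deriv_on ?S (nderiv ?S f (map v xs)) z)"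
      by (rule has_derivative_linear[OF deriv_on_has_derivative[OF diff[OF xs] Suc.prems]])
    then show "prod_list (map c xs) *\<^sub>R deriv_on ?S (nderiv ?S f (map v xs)) z ?T =
        (\<Sum>x\<in>X. prod_list (map c (x # xs)) *\<^sub>R nderiv ?S f (map v (x # xs)) z)"
      by (simp add: linear_sum linear_scale scaleR_sum_right mult.commute)
  qed
  also have "\<dots> = (\<Sum>(xs, x)\<in>?L \<times> X. prod_list (map c (x # xs)) *\<^sub>R nderiv ?S f (map v (x # xs)) z)"
    by (rule sum.cartesian_product)
  also have "\<dots> = (\<Sum>xs | set xs \<subseteq> X \<and> length xs = Suc m.
      prod_list (map c xs) *\<^sub>R nderiv ?S f (map v xs) z)"
    unfolding lists_length_Suc_eq
    by (subst sum.reindex) (auto simp: inj_split_Cons case_prod_beta)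
  finally show ?case .
qed

lemma abs_prod_list_map_le:
  fixes c :: "'b \<Rightarrow> real"
  assumes "\<And>x. x \<in> set xs \<Longrightarrow> \<bar>c x\<bar> \<le> B" "0 \<le> B"
  shows "\<bar>prod_list (map c xs)\<bar> \<le> B ^ length xs"
  using assms by (induction xs) (auto simp: abs_mult intro!: mult_mono)

text \<open>
  Expanding \<open>u\<close> in the standard basis reduces the bound to finitely many functions of \<open>z\<close>,
  which are continuous and hence bounded near \<open>y\<close>.
\<close>

lemma nderiv_replicate_bound:
  assumes y: "y \<in> Rn N"
  shows "\<exists>B\<ge>0. \<exists>d>0. \<forall>z\<in>Rn N. \<forall>u\<in>Rn N. dist z y < d \<longrightarrow>
    norm (nderiv (Rn N) f (replicate m u) z) \<le> B * norm u ^ m"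
proof -
  let ?S = "Rn N"
  let ?L = "{xs. set xs \<subseteq> {..<N} \<and> length xs = m}"
  let ?G = "\<lambda>xs z. nderiv ?S f (map unit_vec xs) z"
  have fin: "finite ?L" by (rule finite_lists_length_eq) simp
  have "\<forall>xs\<in>?L. \<forall>\<^sub>F z in at y within ?S. norm (?G xs z) \<le> norm (?G xs y) + 1"
  proof
    fix xs assume "xs \<in> ?L"
    then have "continuous_on ?S (?G xs)"
      by (intro nderiv_continuous_on[OF smooth]) (auto simp: unit_vec_Rn)
    then have "((\<lambda>z. norm (?G xs z)) \<longlongrightarrow> norm (?G xs y)) (at y within ?S)"
      using y by (auto simp: continuous_on_def intro: tendsto_norm)
    from order_tendstoD(2)[OF this, of "norm (?G xs y) + 1"]
    show "\<forall>\<^sub>F z in at y within ?S. norm (?G xs z) \<le> norm (?G xs y) + 1"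
      by (auto elim: eventually_mono)
  qed
  then have "\<forall>\<^sub>F z in at y within ?S. \<forall>xs\<in>?L. norm (?G xs z) \<le> norm (?G xs y) + 1"
    by (rule eventually_ball_finite[OF fin])
  then obtain d where d: "d > 0"
    "\<And>z xs. z \<in> ?S \<Longrightarrow> dist z y < d \<Longrightarrow> xs \<in> ?L \<Longrightarrow> norm (?G xs z) \<le> norm (?G xs y) + 1"
    unfolding eventually_at by (metis (no_types, lifting) le_add_same_cancel1 zero_le_one)
  define B where "B = (\<Sum>xs\<in>?L. norm (?G xs y) + 1)"
  have "B \<ge> 0" unfolding B_def by (rule sum_nonneg) auto
  moreover have "norm (nderiv ?S f (replicate m u) z) \<le> B * norm u ^ m"
    if z: "z \<in> ?S" and u: "u \<in> ?S" and "dist z y < d" for z u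
  proof -
    have "nderiv ?S f (replicate m u) z = nderiv ?S f (replicate m (\<Sum>i<N. coord u i *\<^sub>R unit_vec i)) z"
      using Rn_basis_expansion[OF u] by simp
    also have "\<dots> = (\<Sum>xs\<in>?L. prod_list (map (coord u) xs) *\<^sub>R ?G xs z)"
      by (rule nderiv_replicate_expansion[OF _ _ z]) (auto simp: unit_vec_Rn)
    also have "norm \<dots> \<le> (\<Sum>xs\<in>?L. norm (prod_list (map (coord u) xs) *\<^sub>R ?G xs z))"
      by (rule norm_sum)
    also have "\<dots> \<le> (\<Sum>xs\<in>?L. norm u ^ m * (norm (?G xs y) + 1))"
    proof (rule sum_mono)
      fix xs assume xs: "xs \<in> ?L"
      have "\<bar>prod_list (map (coord u) xs)\<bar> \<le> norm u ^ length xs"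
        by (rule abs_prod_list_map_le) (auto intro: abs_coord_le_norm)
      then show "norm (prod_list (map (coord u) xs) *\<^sub>R ?G xs z) \<le> norm u ^ m * (norm (?G xs y) + 1)"
        using d(2)[OF z that(3) xs] xs by (auto intro!: mult_mono)
    qed
    also have "\<dots> = B * norm u ^ m"
      by (simp add: B_def sum_distrib_left mult.commute)
    finally show ?thesis .
  qed
  ultimately show ?thesis using d(1) by blast
qed

text \<open>
  Lagrange's remainder for each coordinate along the line through \<open>z\<close> in direction \<open>u\<close>. Each of
  the \<open>N\<close> coordinates has its own intermediate point, so the coordinate bounds are added up.
\<close>

lemma taylor_remainder_bound:
  assumes z: "z \<in> Rn N" and u: "u \<in> Rn N"
    and B: "\<And>t. \<bar>t\<bar> \<le> 1 \<Longrightarrow> norm (nderiv (Rn N) f (replicate n u) (z + t *\<^sub>R u)) \<le> B"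
  shows "norm (f (z + u) - (\<Sum>m<n. (1 / fact m) *\<^sub>R nderiv (Rn N) f (replicate m u) z)) \<le> real N * B"
proof (rule norm_le_coord_bound)
  have S: "nderiv (Rn N) f (replicate m u) z \<in> Rn N" for m
    by (rule funcset_mem[OF nderiv_in_Rn z]) (use u in auto)
  have "f (z + u) \<in> Rn N"
    using maps_Rn z u subspace_Rn by (auto simp: subspace_add)
  then show "f (z + u) - (\<Sum>m<n. (1 / fact m) *\<^sub>R nderiv (Rn N) f (replicate m u) z) \<in> Rn N"
    using S subspace_Rn by (intro subspace_diff subspace_sum subspace_scale) auto
  fix i
  let ?D = "\<lambda>m t. coord (nderiv (Rn N) f (replicate m u) (z + t *\<^sub>R u)) i"
  have "\<forall>m t. (?D m has_real_derivative ?D (Suc m) t) (at t)"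
    using coord_deriv_along_line[OF nderiv_differentiable_on[OF smooth] z u, of "replicate m u" for m] u
    by (auto simp: set_replicate_conv_if)
  from Maclaurin_all_le[OF refl this, of 1 n] obtain t where t: "\<bar>t\<bar> \<le> 1"
    "?D 0 1 = (\<Sum>m<n. (?D m 0 / fact m) * 1 ^ m) + (?D n t / fact n) * 1 ^ n"
    by auto
  have "\<bar>?D n t / fact n\<bar> \<le> \<bar>?D n t\<bar> / 1"
    unfolding abs_divide by (rule divide_left_mono) (auto simp: fact_ge_1)
  also have "\<dots> \<le> B"
    using abs_coord_le_norm[of "nderiv (Rn N) f (replicate n u) (z + t *\<^sub>R u)" i] B[OF t(1)] by simp
  finally have "\<bar>?D n t / fact n\<bar> \<le> B" .
  then show "\<bar>coord (f (z + u) - (\<Sum>m<n. (1 / fact m) *\<^sub>R nderiv (Rn N) f (replicate m u) z)) i\<bar> \<le> B"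
    using t(2) by (simp add: lookup_minus lookup_sum)
qed

lemma taylor_approximation:
  assumes y: "y \<in> Rn N"
  shows "\<exists>B d. d > 0 \<and> (\<forall>u\<in>Rn N. norm u < d \<longrightarrow>
    norm (f (y + u) - (\<Sum>m<n. (1 / fact m) *\<^sub>R nderiv (Rn N) f (replicate m u) y)) \<le> B * norm u ^ n)"
proof -
  obtain B d where B: "B \<ge> 0" "d > 0"
    "\<And>z u. z \<in> Rn N \<Longrightarrow> u \<in> Rn N \<Longrightarrow> dist z y < d \<Longrightarrow>
      norm (nderiv (Rn N) f (replicate n u) z) \<le> B * norm u ^ n"
    using nderiv_replicate_bound[OF y, of n] by blast
  have "norm (f (y + u) - (\<Sum>m<n. (1 / fact m) *\<^sub>R nderiv (Rn N) f (replicate m u) y)) \<le>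
      (real N * B) * norm u ^ n" if u: "u \<in> Rn N" "norm u < d" for u
    unfolding mult.assoc
  proof (rule taylor_remainder_bound[OF y u(1)])
    fix t :: real assume "\<bar>t\<bar> \<le> 1"
    then have "\<bar>t\<bar> * norm u \<le> norm u" by (simp add: mult_left_le_one_le)
    then show "norm (nderiv (Rn N) f (replicate n u) (y + t *\<^sub>R u)) \<le> B * norm u ^ n"
      using u y subspace_Rn by (intro B) (auto simp: subspace_add subspace_scale dist_norm)
  qed
  with B(2) show ?thesis by blast
qed

text \<open>
  Taylor approximation of order one, based at the variable point \<open>y + w\<close>.
\<close>

lemma locally_lipschitz:
  assumes y: "y \<in> Rn N"
  shows "\<exists>B d. d > 0 \<and> (\<forall>u\<in>Rn N. \<forall>w\<in>Rn N. norm u < d \<longrightarrow> norm w < d \<longrightarrow>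
    norm (f (y + u) - f (y + w)) \<le> B * norm (u - w))"
proof -
  obtain B d where B: "B \<ge> 0" "d > 0"
    "\<And>z u. z \<in> Rn N \<Longrightarrow> u \<in> Rn N \<Longrightarrow> dist z y < d \<Longrightarrow>
      norm (nderiv (Rn N) f (replicate 1 u) z) \<le> B * norm u ^ 1"
    using nderiv_replicate_bound[OF y, of 1] by blast
  have "norm (f (y + u) - f (y + w)) \<le> (real N * B) * norm (u - w)"
    if u: "u \<in> Rn N" "norm u < d / 3" and w: "w \<in> Rn N" "norm w < d / 3" for u w
  proof -
    \<comment> \<open>the radius \<open>d / 3\<close> keeps \<open>w + t (u - w)\<close> below \<open>d\<close> for all \<open>\<bar>t\<bar> \<le> 1\<close>\<close>
    have uw: "u - w \<in> Rn N" "y + w \<in> Rn N"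
      using u w y subspace_Rn by (auto simp: subspace_diff subspace_add)
    have "norm (f (y + w + (u - w)) - (\<Sum>m<1. (1 / fact m) *\<^sub>R nderiv (Rn N) f (replicate m (u - w)) (y + w)))
        \<le> real N * (B * norm (u - w) ^ 1)"
    proof (rule taylor_remainder_bound[OF uw(2,1)])
      fix t :: real assume t: "\<bar>t\<bar> \<le> 1"
      have "norm (w + t *\<^sub>R (u - w)) \<le> norm w + \<bar>t\<bar> * norm (u - w)"
        by (metis norm_scaleR norm_triangle_ineq)
      also have "\<dots> \<le> norm w + norm (u - w)"
        using t by (simp add: mult_left_le_one_le)
      also have "\<dots> < d"
        using u w norm_triangle_ineq4[of u w] by linarith
      finally have "norm (w + t *\<^sub>R (u - w)) < d" .
      then have "dist (y + w + t *\<^sub>R (u - w)) y < d" by (simp add: dist_norm add.assoc)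
      then show "norm (nderiv (Rn N) f (replicate 1 (u - w)) (y + w + t *\<^sub>R (u - w))) \<le> B * norm (u - w) ^ 1"
        using uw subspace_Rn by (intro B) (auto simp: subspace_add subspace_scale)
    qed
    then show ?thesis by simp
  qed
  moreover have "d / 3 > 0" using B by simp
  ultimately show ?thesis by blast
qed

end

section \<open>Orders of vanishing at step size zero\<close>

definition vanishes_to_order :: "nat \<Rightarrow> (real \<Rightarrow> 'a::real_normed_vector) \<Rightarrow> bool" where
  "vanishes_to_order k g \<longleftrightarrow> (\<exists>B. \<forall>\<^sub>F h in at 0. norm (g h) \<le> B * \<bar>h\<bar> ^ k)"

lemma vanishes_to_orderI:
  "\<forall>\<^sub>F h in at 0. norm (g h) \<le> B * \<bar>h\<bar> ^ k \<Longrightarrow> vanishes_to_order k g"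
  by (auto simp: vanishes_to_order_def)

lemma vanishes_to_orderE:
  assumes "vanishes_to_order k g"
  obtains B where "B \<ge> 0" "\<forall>\<^sub>F h in at 0. norm (g h) \<le> B * \<bar>h\<bar> ^ k"
proof -
  from assms obtain B where B: "\<forall>\<^sub>F h in at 0. norm (g h) \<le> B * \<bar>h\<bar> ^ k"
    by (auto simp: vanishes_to_order_def)
  then have "\<forall>\<^sub>F h in at 0. norm (g h) \<le> \<bar>B\<bar> * \<bar>h\<bar> ^ k"
    by (rule eventually_mono) (meson abs_ge_self abs_ge_zero mult_right_mono order_trans zero_le_power)
  then show ?thesis using that[of "\<bar>B\<bar>"] by simp
qed

lemma vanishes_zero [simp]: "vanishes_to_order k (\<lambda>h. 0)"
  by (rule vanishes_to_orderI[of _ 0]) simp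

lemma eventually_abs_less: "d > 0 \<Longrightarrow> \<forall>\<^sub>F h::real in at 0. \<bar>h\<bar> < d"
  unfolding eventually_at by (rule exI[of _ d]) (simp add: dist_norm)

lemma vanishes_add:
  assumes "vanishes_to_order k g" "vanishes_to_order k g'"
  shows "vanishes_to_order k (\<lambda>h. g h + g' h)"
proof -
  obtain B B' where "\<forall>\<^sub>F h in at 0. norm (g h) \<le> B * \<bar>h\<bar> ^ k" "\<forall>\<^sub>F h in at 0. norm (g' h) \<le> B' * \<bar>h\<bar> ^ k"
    using assms by (auto simp: vanishes_to_order_def)
  then have "\<forall>\<^sub>F h in at 0. norm (g h + g' h) \<le> (B + B') * \<bar>h\<bar> ^ k"
    by eventually_elim (metis add_mono distrib_right norm_triangle_le)
  then show ?thesis by (rule vanishes_to_orderI)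
qed

lemma vanishes_linear_image:
  assumes "vanishes_to_order k g" "bounded_linear A"
  shows "vanishes_to_order k (\<lambda>h. A (g h))"
proof -
  obtain B where B: "\<forall>\<^sub>F h in at 0. norm (g h) \<le> B * \<bar>h\<bar> ^ k"
    using assms by (auto simp: vanishes_to_order_def)
  obtain C where C: "C \<ge> 0" "\<And>x. norm (A x) \<le> norm x * C"
    using bounded_linear.nonneg_bounded[OF assms(2)] by blast
  from B have "\<forall>\<^sub>F h in at 0. norm (A (g h)) \<le> (B * C) * \<bar>h\<bar> ^ k"
  proof eventually_elim
    case (elim h)
    have "norm (A (g h)) \<le> norm (g h) * C" by (rule C)
    also have "\<dots> \<le> (B * \<bar>h\<bar> ^ k) * C" by (rule mult_right_mono[OF elim C(1)])
    finally show ?case by (simp add: mult_ac)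
  qed
  then show ?thesis by (rule vanishes_to_orderI)
qed

lemma vanishes_scaleR: "vanishes_to_order k g \<Longrightarrow> vanishes_to_order k (\<lambda>h. c *\<^sub>R g h)"
  by (rule vanishes_linear_image[OF _ bounded_linear_scaleR_right])

lemma vanishes_diff:
  "vanishes_to_order k g \<Longrightarrow> vanishes_to_order k g' \<Longrightarrow> vanishes_to_order k (\<lambda>h. g h - g' h)"
  using vanishes_add[of k g "\<lambda>h. - 1 *\<^sub>R g' h"] vanishes_scaleR[of k g' "-1"] by simp

lemma vanishes_sum:
  "(\<And>x. x \<in> X \<Longrightarrow> vanishes_to_order k (g x)) \<Longrightarrow> vanishes_to_order k (\<lambda>h. \<Sum>x\<in>X. g x h)"
  by (induction X rule: infinite_finite_induct) (auto intro: vanishes_add)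

lemma vanishes_mono:
  assumes "vanishes_to_order l g" "k \<le> l"
  shows "vanishes_to_order k g"
proof -
  obtain B where B: "B \<ge> 0" "\<forall>\<^sub>F h in at 0. norm (g h) \<le> B * \<bar>h\<bar> ^ l"
    by (rule vanishes_to_orderE[OF assms(1)])
  from B(2) eventually_abs_less[OF zero_less_one] have "\<forall>\<^sub>F h in at 0. norm (g h) \<le> B * \<bar>h\<bar> ^ k"
  proof eventually_elim
    case (elim h)
    have "\<bar>h\<bar> ^ l \<le> \<bar>h\<bar> ^ k" using elim assms(2) by (intro power_decreasing) auto
    then show ?case using elim(1) B(1) by (meson mult_left_mono order_trans)
  qed
  then show ?thesis by (rule vanishes_to_orderI)
qed

lemma vanishes_power_scaleR:
  assumes "vanishes_to_order k g"
  shows "vanishes_to_order (l + k) (\<lambda>h. h ^ l *\<^sub>R g h)"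
proof -
  obtain B where "\<forall>\<^sub>F h in at 0. norm (g h) \<le> B * \<bar>h\<bar> ^ k"
    using assms by (auto simp: vanishes_to_order_def)
  then have "\<forall>\<^sub>F h in at 0. norm (h ^ l *\<^sub>R g h) \<le> B * \<bar>h\<bar> ^ (l + k)"
  proof eventually_elim
    case (elim h)
    then have "\<bar>h\<bar> ^ l * norm (g h) \<le> \<bar>h\<bar> ^ l * (B * \<bar>h\<bar> ^ k)" by (intro mult_left_mono) auto
    then show ?case by (simp add: power_add power_abs mult_ac)
  qed
  then show ?thesis by (rule vanishes_to_orderI)
qed

lemma vanishes_const: "vanishes_to_order 0 (\<lambda>h. c)"
  by (rule vanishes_to_orderI[of _ "norm c"]) simp

lemma vanishes_power: "k \<le> l \<Longrightarrow> vanishes_to_order k (\<lambda>h. h ^ l *\<^sub>R c)"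
  using vanishes_mono[OF vanishes_power_scaleR[OF vanishes_const, of l c]] by simp

lemma vanishes_imp_small:
  assumes "vanishes_to_order 1 g" "d > 0"
  shows "\<forall>\<^sub>F h in at 0. norm (g h) < d"
proof -
  obtain B where B: "B \<ge> 0" "\<forall>\<^sub>F h in at 0. norm (g h) \<le> B * \<bar>h\<bar> ^ 1"
    by (rule vanishes_to_orderE[OF assms(1)])
  have "d / (B + 1) > 0" using assms(2) B(1) by simp
  from B(2) eventually_abs_less[OF this] show ?thesis
  proof eventually_elim
    case (elim h)
    have "B * \<bar>h\<bar> \<le> (B + 1) * \<bar>h\<bar>" by (intro mult_right_mono) auto
    also have "\<dots> < d" using elim(2) B(1) by (simp add: field_simps)
    finally show ?case using elim(1) by simp
  qed
qed

lemma vanishes_imp_bigo: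
  assumes "vanishes_to_order k g"
  shows "(\<lambda>h. norm (g h)) \<in> O[at 0](\<lambda>h. h ^ k)"
proof -
  obtain B where B: "\<forall>\<^sub>F h in at 0. norm (g h) \<le> B * \<bar>h\<bar> ^ k"
    using assms by (auto simp: vanishes_to_order_def)
  then show ?thesis
    by (intro bigoI[of _ B]) (auto elim!: eventually_mono simp: power_abs)
qed

text \<open>
  Uniqueness of asymptotic expansions: the constant term is the limit at zero, and once it is known
  to vanish, a factor \<open>h\<close> can be cancelled.
\<close>

lemma polynomial_coefficients_vanish:
  fixes d :: "nat \<Rightarrow> 'a::real_normed_vector"
  assumes "vanishes_to_order (Suc n) (\<lambda>h. \<Sum>j\<le>n. h ^ j *\<^sub>R d j)"
  shows "j \<le> n \<Longrightarrow> d j = 0"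
  using assms
proof (induction n arbitrary: d j)
  case 0
  have "\<not> norm (d 0) > 0"
    using vanishes_imp_small[of "\<lambda>h. d 0" "norm (d 0)"] 0 by auto
  then show ?case using 0 by simp
next
  case (Suc n)
  have d0: "d 0 = 0"
  proof -
    let ?p = "\<lambda>h. \<Sum>j\<le>Suc n. h ^ j *\<^sub>R d j"
    have "vanishes_to_order 1 ?p"
      by (rule vanishes_mono[OF Suc.prems(2)]) simp
    then have "(?p \<longlongrightarrow> 0) (at 0)"
      by (intro tendstoI) (use vanishes_imp_small in auto)
    moreover have "(?p \<longlongrightarrow> ?p 0) (at 0)"
      by (intro tendsto_intros)
    ultimately have "?p 0 = 0"
      using LIM_unique by blast
    then show ?thesis
      by (simp add: sum.atMost_Suc_shift del: sum.atMost_Suc)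
  qed
  have eq: "(\<Sum>j\<le>Suc n. h ^ j *\<^sub>R d j) = h *\<^sub>R (\<Sum>j\<le>n. h ^ j *\<^sub>R d (Suc j))" for h
    by (simp add: sum.atMost_Suc_shift d0 scaleR_sum_right del: sum.atMost_Suc)
  obtain B where B: "\<forall>\<^sub>F h in at 0. norm (h *\<^sub>R (\<Sum>j\<le>n. h ^ j *\<^sub>R d (Suc j))) \<le> B * \<bar>h\<bar> ^ Suc (Suc n)"
    using vanishes_to_orderE[OF Suc.prems(2)] unfolding eq by blast
  moreover have "\<forall>\<^sub>F h::real in at 0. h \<noteq> 0"
    by (rule eventually_neq_at_within)
  ultimately have "\<forall>\<^sub>F h in at 0. norm (\<Sum>j\<le>n. h ^ j *\<^sub>R d (Suc j)) \<le> B * \<bar>h\<bar> ^ Suc n"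
  proof eventually_elim
    case (elim h)
    then have "\<bar>h\<bar> * norm (\<Sum>j\<le>n. h ^ j *\<^sub>R d (Suc j)) \<le> \<bar>h\<bar> * (B * \<bar>h\<bar> ^ Suc n)"
      by (simp add: mult_ac)
    then show ?case by (rule mult_left_le_imp_le) (use elim(2) in simp)
  qed
  then have "vanishes_to_order (Suc n) (\<lambda>h. \<Sum>j\<le>n. h ^ j *\<^sub>R d (Suc j))"
    by (rule vanishes_to_orderI)
  then show ?case using Suc.IH[of _ "\<lambda>j. d (Suc j)"] Suc.prems(1) d0 by (cases j) auto
qed

section \<open>The phi functions of a bounded operator\<close>

text \<open>
  The space of all finitely supported sequences is not complete, so convergence is obtained from
  the finitely many coordinates of \<open>Rn N\<close>.
\<close>

lemma dominated_series_Rn: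
  assumes z: "\<And>i. z i \<in> Rn N" and m: "\<And>i. norm (z i) \<le> m i" "summable m"
  shows "summable z" "suminf z \<in> Rn N" "norm (suminf z) \<le> suminf m"
proof -
  define L where "L = (\<Sum>j<N. suminf (\<lambda>i. coord (z i) j) *\<^sub>R unit_vec j)"
  have "(\<lambda>i. coord (z i) j) sums suminf (\<lambda>i. coord (z i) j)" for j
    by (intro summable_sums summable_comparison_test'[OF m(2)])
      (metis abs_coord_le_norm m(1) order_trans real_norm_def)
  then have "(\<lambda>i. \<Sum>j<N. coord (z i) j *\<^sub>R unit_vec j) sums L"
    unfolding L_def by (intro sums_sum bounded_linear.sums[OF bounded_linear_scaleR_left])
  then have sums: "z sums L"
    using Rn_basis_expansion[OF z] by simp
  then show "summable z" by (rule sums_summable)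
  have L: "suminf z = L" using sums by (rule sums_unique[symmetric])
  show "suminf z \<in> Rn N"
    unfolding L L_def by (intro subspace_sum subspace_scale subspace_Rn) (auto simp: unit_vec_Rn)
  have "norm (\<Sum>i<n. z i) \<le> suminf m" for n
  proof -
    have "norm (\<Sum>i<n. z i) \<le> (\<Sum>i<n. m i)"
      by (rule sum_norm_le) (rule m(1))
    also have "\<dots> \<le> suminf m"
      by (rule sum_le_suminf[OF m(2)]) (auto intro: order_trans[OF norm_ge_zero m(1)])
    finally show ?thesis .
  qed
  moreover have "(\<lambda>n. norm (\<Sum>i<n. z i)) \<longlonglongrightarrow> norm L"
    using sums by (intro tendsto_norm) (simp add: sums_def)
  ultimately show "norm (suminf z) \<le> suminf m"
    unfolding L by (intro LIMSEQ_le_const2) auto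
qed

lemma bounded_linear_funpow:
  fixes B :: "'a::real_normed_vector \<Rightarrow> 'a"
  assumes "bounded_linear B"
  shows "bounded_linear (B ^^ n)"
proof (induction n)
  case 0
  have "B ^^ 0 = (\<lambda>x. x)" by (rule ext) simp
  then show ?case by (simp only: bounded_linear_ident)
next
  case (Suc n)
  show ?case using bounded_linear_compose[OF assms Suc.IH] by (simp add: o_def)
qed

context
  fixes N :: nat and B :: "rvec \<Rightarrow> rvec" and b :: real
  assumes lin: "bounded_linear B" and maps: "B \<in> Rn N \<rightarrow> Rn N"
    and bound: "\<And>x. norm (B x) \<le> b * norm x" and b: "0 \<le> b"
begin

lemma funpow_Rn: "x \<in> Rn N \<Longrightarrow> (B ^^ n) x \<in> Rn N"
  using maps by (induction n) auto

lemma norm_funpow_le: "norm ((B ^^ n) x) \<le> b ^ n * norm x"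
proof (induction n)
  case (Suc n)
  have "norm ((B ^^ Suc n) x) \<le> b * norm ((B ^^ n) x)" using bound by simp
  also have "\<dots> \<le> b * (b ^ n * norm x)" using Suc b by (rule mult_left_mono)
  finally show ?case by (simp add: mult.assoc)
qed simp

lemma phi_fun_convergent:
  assumes x: "x \<in> Rn N"
  shows "summable (\<lambda>i. (1 / fact (i + k)) *\<^sub>R (B ^^ i) x)"
    and "phi_fun k B x \<in> Rn N" and "norm (phi_fun k B x) \<le> exp b * norm x"
proof -
  let ?z = "\<lambda>i. (1 / fact (i + k)) *\<^sub>R (B ^^ i) x" and ?m = "\<lambda>i. (b ^ i /\<^sub>R fact i) * norm x"
  have z: "?z i \<in> Rn N" for i
    using funpow_Rn[OF x] subspace_Rn by (simp add: subspace_scale)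
  have m: "norm (?z i) \<le> ?m i" for i
  proof -
    have "1 / fact (i + k) \<le> (1 / fact i :: real)"
      by (intro divide_left_mono fact_mono) auto
    then have "(1 / fact (i + k)) * norm ((B ^^ i) x) \<le> (1 / fact i) * (b ^ i * norm x)"
      by (rule mult_mono[OF _ norm_funpow_le]) auto
    then show ?thesis by (simp add: field_simps)
  qed
  have sm: "?m sums (exp b * norm x)"
    by (rule sums_mult2[OF exp_converges])
  note dominated = dominated_series_Rn[OF z m sums_summable[OF sm]]
  show "summable ?z" "phi_fun k B x \<in> Rn N"
    using dominated(1,2) by (simp_all add: phi_fun_def)
  show "norm (phi_fun k B x) \<le> exp b * norm x"
    using dominated(3) sums_unique[OF sm] by (simp add: phi_fun_def)
qed

text \<open>
  The tail of the series is again of the form \<open>B\<^sup>n \<phi>\<^sub>n\<^sub>+\<^sub>k(B) x\<close>, which makes its order in \<open>h\<close>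
  visible when \<open>B = g h A\<close>.
\<close>

lemma phi_fun_split:
  assumes x: "x \<in> Rn N"
  shows "phi_fun k B x = (\<Sum>i<n. (1 / fact (i + k)) *\<^sub>R (B ^^ i) x) + (B ^^ n) (phi_fun (n + k) B x)"
proof -
  interpret P: bounded_linear "B ^^ n" by (rule bounded_linear_funpow[OF lin])
  have pow: "(B ^^ (i + n)) x = (B ^^ n) ((B ^^ i) x)" for i
    by (subst add.commute) (simp add: funpow_add)
  have "phi_fun k B x = (\<Sum>i<n. (1 / fact (i + k)) *\<^sub>R (B ^^ i) x)
      + suminf (\<lambda>i. (1 / fact (i + n + k)) *\<^sub>R (B ^^ (i + n)) x)"
    unfolding phi_fun_def
    by (subst suminf_split_initial_segment[OF phi_fun_convergent(1)[OF x], of k n]) (simp add: add_ac)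
  also have "suminf (\<lambda>i. (1 / fact (i + n + k)) *\<^sub>R (B ^^ (i + n)) x) =
      suminf (\<lambda>i. (B ^^ n) ((1 / fact (i + (n + k))) *\<^sub>R (B ^^ i) x))"
    by (simp add: P.scaleR add.assoc pow)
  also have "\<dots> = (B ^^ n) (phi_fun (n + k) B x)"
    unfolding phi_fun_def by (rule P.suminf[OF phi_fun_convergent(1)[OF x], symmetric])
  finally show ?thesis .
qed

end

section \<open>Trees, their sub-trees and their symmetries\<close>

lemma tree_order_pos: "0 < tree_order \<tau>"
  by (cases \<tau>) auto

lemma tree_order_child_le: "t \<in># ts \<Longrightarrow> tree_order t \<le> sum_mset (image_mset tree_order ts)"
  by (auto dest!: multi_member_split)

text \<open>
  Without this, the sums over all trees of bounded order would be zero by convention.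
\<close>

lemma finite_trees_of_bounded_order: "finite {\<tau>. tree_order \<tau> \<le> K}"
proof (induction K)
  case 0
  have "\<not> tree_order \<tau> \<le> 0" for \<tau>
    using tree_order_pos[of \<tau>] by simp
  then have "{\<tau>. tree_order \<tau> \<le> 0} = {}" by blast
  then show ?case by (simp only: finite.emptyI)
next
  case (Suc K)
  let ?T = "{\<tau>. tree_order \<tau> \<le> K}"
  let ?L = "{xs. set xs \<subseteq> ?T \<and> length xs \<le> K}"
  have "{\<tau>. tree_order \<tau> \<le> Suc K} \<subseteq> Fat ` ?T \<union> (\<lambda>xs. Meagre (mset xs)) ` ?L"
  proof
    fix \<tau> assume "\<tau> \<in> {\<tau>. tree_order \<tau> \<le> Suc K}"
    then have ord: "tree_order \<tau> \<le> Suc K" by simp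
    show "\<tau> \<in> Fat ` ?T \<union> (\<lambda>xs. Meagre (mset xs)) ` ?L"
    proof (cases \<tau>)
      case (Meagre ts)
      obtain xs where xs: "mset xs = ts" using ex_mset by blast
      have sum: "sum_mset (image_mset tree_order ts) \<le> K" using ord Meagre by simp
      have "tree_order t \<le> K" if "t \<in> set xs" for t
        using tree_order_child_le[of t ts] sum that xs by (metis order_trans set_mset_mset)
      then have "set xs \<subseteq> ?T" by blast
      moreover have "length xs \<le> sum_list (map tree_order xs)"
      proof (induction xs)
        case (Cons t xs)
        then show ?case using tree_order_pos[of t] by simp
      qed simp
      then have "length xs \<le> K"
        using sum xs[symmetric] by (simp add: sum_mset_sum_list[symmetric] mset_map[symmetric] del: mset_map)
      ultimately show ?thesis using Meagre xs by blast
    qed (use ord in auto)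
  qed
  moreover have "finite ?L" by (rule finite_lists_length_le[OF Suc.IH])
  ultimately show ?case using Suc.IH by (meson finite_Un finite_imageI finite_subset)
qed

lemma finite_vertices: "finite (vertices \<tau>)"
proof (induction \<tau> rule: measure_induct_rule[of tree_order])
  case (less \<tau>)
  have child: "tree_order t < tree_order \<tau>" if "t \<in># children \<tau>" for t
    using that tree_order_child_le by (cases \<tau>) (auto simp: less_Suc_eq_le)
  have "vertices \<tau> \<subseteq> insert [] (\<Union>t\<in>set_mset (children \<tau>). \<Union>i<count (children \<tau>) t. (\<lambda>p. (t, i) # p) ` vertices t)"
  proof
    fix v assume "v \<in> vertices \<tau>"
    then show "v \<in> insert [] (\<Union>t\<in>set_mset (children \<tau>). \<Union>i<count (children \<tau>) t. (\<lambda>p. (t, i) # p) ` vertices t)"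
      by (cases v) (force simp: vertices_def intro: count_inI)+
  qed
  moreover have "finite (insert [] (\<Union>t\<in>set_mset (children \<tau>). \<Union>i<count (children \<tau>) t. (\<lambda>p. (t, i) # p) ` vertices t))"
    using less.IH[OF child] by blast
  ultimately show ?case by (rule finite_subset)
qed

text \<open>
  The identity is an automorphism, and there are only finitely many vertices to permute.
\<close>

lemma symmetry_pos: "0 < symmetry \<tau>"
proof -
  have "id \<in> automorphisms \<tau>"
    by (simp add: automorphisms_def permutes_id)
  moreover have "finite (automorphisms \<tau>)"
    by (rule finite_subset[OF _ finite_permutations[OF finite_vertices[of \<tau>]]])
      (auto simp: automorphisms_def)
  ultimately show ?thesis
    by (auto simp: symmetry_def card_gt_0_iff)
qed

lemma subtrees_rec: "subtrees \<tau> = insert \<tau> (\<Union>t\<in>set_mset (children \<tau>). subtrees t)"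
proof (intro equalityI subsetI)
  fix u assume "u \<in> subtrees \<tau>"
  then obtain v where v: "is_vertex \<tau> v" "u = subtree_at \<tau> v"
    by (auto simp: subtrees_def vertices_def)
  show "u \<in> insert \<tau> (\<Union>t\<in>set_mset (children \<tau>). subtrees t)"
  proof (cases v)
    case (Cons e p)
    obtain t i where e: "e = (t, i)" by (cases e)
    then have "t \<in># children \<tau>" "is_vertex t p" "u = subtree_at t p"
      using v Cons by (auto intro: count_inI)
    then show ?thesis by (auto simp: subtrees_def vertices_def)
  qed (use v in simp)
next
  fix u assume "u \<in> insert \<tau> (\<Union>t\<in>set_mset (children \<tau>). subtrees t)"
  then consider "u = \<tau>" | t p where "t \<in># children \<tau>" "is_vertex t p" "u = subtree_at t p"
    by (auto simp: subtrees_def vertices_def)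
  then show "u \<in> subtrees \<tau>"
  proof cases
    case 1
    then show ?thesis
      unfolding subtrees_def vertices_def by (intro image_eqI[of _ _ "[]"]) auto
  next
    case 2
    then show ?thesis
      unfolding subtrees_def vertices_def by (intro image_eqI[of _ _ "(t, 0) # p"]) auto
  qed
qed

lemma linear_tree_rec:
  "linear_tree \<tau> \<longleftrightarrow> size (children \<tau>) \<le> 1 \<and> (\<forall>t\<in>#children \<tau>. linear_tree t)"
  unfolding linear_tree_def by (subst subtrees_rec) auto

lemma TK_rec:
  "\<tau> \<in> TK k \<longleftrightarrow> \<not> (linear_tree \<tau> \<and> tree_order \<tau> \<le> k \<and> is_fat \<tau>) \<and> (\<forall>t\<in>#children \<tau>. t \<in> TK k)"
  unfolding TK_def mem_Collect_eq by (subst subtrees_rec) auto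

section \<open>Reduction of trees to the Krylov class\<close>

text \<open>
  Recolours bottom-up: a fat node becomes meagre when it is the root of a linear sub-tree of order at
  most \<open>M\<close>. Linear sub-trees of this size below it have already become meagre, so that its
  child carries a Krylov vector.
\<close>

primrec reduce :: "nat \<Rightarrow> tw_tree \<Rightarrow> tw_tree" where
  "reduce M (Meagre ts) = Meagre (image_mset (reduce M) ts)"
| "reduce M (Fat t) =
     (if linear_tree (reduce M t) \<and> tree_order (reduce M t) < M then Meagre {#reduce M t#}
      else Fat (reduce M t))"

lemma reduce_in_TK: "reduce M \<tau> \<in> TK M"
proof (induction \<tau>)
  case (Meagre ts)
  then show ?case by (subst TK_rec) auto
next
  case (Fat t)
  then show ?case by (subst TK_rec) (auto simp: linear_tree_rec[of "Fat _"])
qed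

lemma tree_order_reduce [simp]: "tree_order (reduce M \<tau>) = tree_order \<tau>"
proof (induction \<tau>)
  case (Meagre ts)
  then have "image_mset (tree_order \<circ> reduce M) ts = image_mset tree_order ts"
    by (intro image_mset_cong) auto
  then show ?case by (simp add: multiset.map_comp)
qed auto

section \<open>The Krylov approximation of the Jacobian\<close>

lemma bounded_linear_dot: "bounded_linear (dot v)"
  unfolding dot_def
  by (intro bounded_linear_sum bounded_linear_const_mult bounded_linear_coord)

lemma bounded_linear_krylov_approx: "bounded_linear (krylov_approx vs J)"
  unfolding krylov_approx_def
  by (intro bounded_linear_sum bounded_linear_scaleR_const bounded_linear_const_mult bounded_linear_dot)

text \<open>
  \<open>V V\<^sup>T\<close> is the identity on the span of the columns of \<open>V\<close>.
\<close>

lemma orthonormal_expansion: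
  assumes on: "orthonormal vs" and x: "x \<in> span (set vs)"
  shows "(\<Sum>i<length vs. dot (vs ! i) x *\<^sub>R vs ! i) = x"
  using x
proof (induction rule: span_induct)
  case base
  interpret D: bounded_linear "dot v" for v by (rule bounded_linear_dot)
  show ?case
    by (auto intro!: subspaceI simp: D.zero D.add D.scaleR scaleR_add_left sum.distrib)
      (simp flip: scaleR_scaleR scaleR_sum_right)
next
  case (step w)
  then obtain k where k: "k < length vs" "w = vs ! k" by (metis in_set_conv_nth)
  have "(\<Sum>i<length vs. dot (vs ! i) w *\<^sub>R vs ! i) = (\<Sum>i<length vs. if i = k then vs ! i else 0)"
    by (rule sum.cong) (use on k in \<open>auto simp: orthonormal_def\<close>)
  then show ?case using k by simp
qed

text \<open>
  On the span, \<open>V V\<^sup>T J V V\<^sup>T x\<close> is \<open>V V\<^sup>T J x\<close>.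
\<close>

lemma krylov_approx_eq_projection:
  assumes on: "orthonormal vs" and x: "x \<in> span (set vs)" and J: "linear J"
  shows "krylov_approx vs J x = (\<Sum>i<length vs. dot (vs ! i) (J x) *\<^sub>R vs ! i)"
proof -
  interpret D: bounded_linear "dot v" for v by (rule bounded_linear_dot)
  have "dot v (J x) = (\<Sum>j<length vs. dot v (J (vs ! j)) * dot (vs ! j) x)" for v
    by (subst orthonormal_expansion[OF on x, symmetric])
      (simp add: linear_sum[OF J] linear_scale[OF J] D.sum D.scaleR mult.commute)
  then show ?thesis by (simp add: krylov_approx_def)
qed

locale krylov_linearization = smooth_vector_field +
  fixes M :: nat and y :: rvec and vs :: "rvec list" and A :: "rvec \<Rightarrow> rvec"
  assumes y: "y \<in> Rn N" and orthonormal: "orthonormal vs"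
    and span: "span (set vs) = krylov_space (Rn N) f M y"
    and A: "A = krylov_approx vs (deriv_on (Rn N) f y)"
begin

abbreviation J :: "rvec \<Rightarrow> rvec" where "J \<equiv> deriv_on (Rn N) f y"
abbreviation F :: "tw_tree \<Rightarrow> rvec" where "F \<equiv> elem_diff (Rn N) f A y"

lemma f_differentiable: "f differentiable_on Rn N"
  using nderiv_differentiable_on[OF smooth, of "[]"] by simp

lemma linear_J: "linear J"
  by (rule has_derivative_linear[OF deriv_on_has_derivative[OF f_differentiable y]])

lemma J_in_Rn: "v \<in> Rn N \<Longrightarrow> J v \<in> Rn N"
  by (rule deriv_on_in_Rn[OF f_differentiable y _ maps_Rn])

lemma krylov_vector_in_Rn: "(J ^^ i) (f y) \<in> Rn N"
  using maps_Rn y J_in_Rn by (induction i) auto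

lemma bounded_linear_A: "bounded_linear A"
  unfolding A by (rule bounded_linear_krylov_approx)

lemma A_in_Rn: "A x \<in> Rn N"
proof -
  have "span (set vs) \<subseteq> Rn N"
    unfolding span krylov_space_def
    by (rule span_minimal[OF _ subspace_Rn]) (use krylov_vector_in_Rn in auto)
  then have "vs ! i \<in> Rn N" if "i < length vs" for i
    using that by (meson nth_mem span_base subsetD)
  then show ?thesis
    unfolding A krylov_approx_def by (intro subspace_sum subspace_scale subspace_Rn) auto
qed

text \<open>
  Both \<open>J\<^sup>i f\<close> and \<open>J\<^sup>i\<^sup>+\<^sup>1 f\<close> lie in the Krylov space, so neither of the two projections in
  \<open>A = V V\<^sup>T J V V\<^sup>T\<close> acts.
\<close>

lemma A_eq_J_on_krylov_vectors:
  assumes "Suc i < M"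
  shows "A ((J ^^ i) (f y)) = J ((J ^^ i) (f y))"
proof -
  have span_vs: "(J ^^ k) (f y) \<in> span (set vs)" if "k < M" for k
    unfolding span krylov_space_def by (intro span_base) (use that in auto)
  have "A ((J ^^ i) (f y)) = (\<Sum>k<length vs. dot (vs ! k) ((J ^^ Suc i) (f y)) *\<^sub>R vs ! k)"
    unfolding A using krylov_approx_eq_projection[OF orthonormal span_vs linear_J] assms by simp
  also have "\<dots> = (J ^^ Suc i) (f y)"
    by (rule orthonormal_expansion[OF orthonormal span_vs[OF assms]])
  finally show ?thesis by simp
qed

lemma F_in_Rn: "F \<tau> \<in> Rn N"
proof (induction \<tau>)
  case (Meagre ts)
  let ?ws = "SOME ws. mset ws = image_mset F ts"
  have "mset ?ws = image_mset F ts" by (rule someI_ex) (rule ex_mset)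
  then have "set ?ws = F ` set_mset ts" by (metis set_image_mset set_mset_mset)
  then have "set ?ws \<subseteq> Rn N" using Meagre by auto
  then show ?case using nderiv_in_Rn y by auto
qed (simp add: A_in_Rn)

text \<open>
  Symmetry of the derivative makes any enumeration of the children as good as the one chosen in
  \<open>elem_diff\<close>.
\<close>

lemma F_Meagre_mset: "F (Meagre (mset ts)) = nderiv (Rn N) f (map F ts) y"
proof -
  let ?ws = "SOME ws. mset ws = image_mset F (mset ts)"
  have ws: "mset ?ws = image_mset F (mset ts)" by (rule someI_ex) (rule ex_mset)
  then have "set ?ws = F ` set ts" by (metis set_image_mset set_mset_mset)
  then have "set ?ws \<subseteq> Rn N" using F_in_Rn by auto
  then have "nderiv (Rn N) f ?ws y = nderiv (Rn N) f (map F ts) y"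
    using ws y by (intro nderiv_mset_cong) auto
  then show ?thesis by simp
qed

text \<open>
  In \<open>TK M\<close> such a tree has meagre nodes only, and a meagre node with one child applies \<open>J\<close>.
\<close>

lemma F_linear_tree:
  assumes "linear_tree \<tau>" "\<tau> \<in> TK M" "tree_order \<tau> \<le> M"
  shows "F \<tau> = (J ^^ (tree_order \<tau> - 1)) (f y)"
  using assms
proof (induction \<tau>)
  case (Meagre ts)
  then have "size ts \<le> 1" by (simp add: linear_tree_rec[of "Meagre ts"])
  then consider "ts = {#}" | t where "ts = {#t#}"
    by (metis One_nat_def le_Suc_eq le_zero_eq size_1_singleton_mset size_eq_0_iff_empty)
  then show ?case
  proof cases
    case 1
    then show ?thesis using F_Meagre_mset[of "[]"] by simp
  next
    case 2
    then have "F t = (J ^^ (tree_order t - 1)) (f y)"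
      using Meagre by (intro Meagre.IH) (auto simp: linear_tree_rec[of "Meagre {#t#}"] TK_rec[of "Meagre {#t#}"])
    moreover have "F (Meagre ts) = J (F t)" using 2 F_Meagre_mset[of "[t]"] by simp
    moreover have "tree_order (Meagre ts) - 1 = Suc (tree_order t - 1)"
      using 2 tree_order_pos[of t] by simp
    ultimately show ?thesis by simp
  qed
next
  case (Fat t)
  then show ?case by (subst (asm) (2) TK_rec) auto
qed

text \<open>
  A recoloured node applies \<open>J\<close> instead of \<open>A\<close>, but only to a Krylov vector \<open>J\<^sup>i f\<close> with
  \<open>i + 1 < M\<close>, where the two operators agree.
\<close>

lemma F_reduce: "F (reduce M \<tau>) = F \<tau>"
proof (induction \<tau>)
  case (Meagre ts)
  then have "image_mset F (image_mset (reduce M) ts) = image_mset F ts"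
    by (auto simp: multiset.map_comp intro!: image_mset_cong)
  then show ?case by simp
next
  case (Fat t)
  show ?case
  proof (cases "linear_tree (reduce M t) \<and> tree_order t < M")
    case True
    then have F: "F (reduce M t) = (J ^^ (tree_order t - 1)) (f y)"
      using F_linear_tree[OF _ reduce_in_TK, of t] by simp
    have "F (reduce M (Fat t)) = J (F (reduce M t))"
      using True F_Meagre_mset[of "[reduce M t]"] by simp
    also have "\<dots> = A (F (reduce M t))"
      unfolding F using True tree_order_pos[of t] by (intro A_eq_J_on_krylov_vectors[symmetric]) simp
    finally show ?thesis using Fat by simp
  qed (use Fat in auto)
qed

end

section \<open>Tree expansions up to a fixed order\<close>

definition tree_sum ::
  "nat \<Rightarrow> nat \<Rightarrow> (tw_tree \<Rightarrow> real) \<Rightarrow> nat \<Rightarrow> (rvec \<Rightarrow> rvec) \<Rightarrow> rvec \<Rightarrow> (rvec \<Rightarrow> rvec) \<Rightarrow> real \<Rightarrow> rvec" where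
  "tree_sum M K \<beta> N f y A h =
     (\<Sum>\<tau> | \<tau> \<in> TK M \<and> tree_order \<tau> \<le> K. (\<beta> \<tau> * h ^ tree_order \<tau>) *\<^sub>R elem_diff (Rn N) f A y \<tau>)"

text \<open>
  \<open>U\<close> is a vector depending on the data \<open>N, f, y, A\<close> and on the step size. The
  coefficients \<open>\<beta>\<close> are fixed before the data: they must serve all problems at once.
\<close>

definition expands_with ::
  "nat \<Rightarrow> nat \<Rightarrow> (tw_tree \<Rightarrow> real) \<Rightarrow>
    (nat \<Rightarrow> (rvec \<Rightarrow> rvec) \<Rightarrow> rvec \<Rightarrow> (rvec \<Rightarrow> rvec) \<Rightarrow> real \<Rightarrow> rvec) \<Rightarrow> bool" where
  "expands_with M K \<beta> U \<longleftrightarrow> (\<forall>N f y vs A. krylov_linearization N f M y vs A \<longrightarrow>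
     (\<forall>h. U N f y A h \<in> Rn N) \<and>
     vanishes_to_order (Suc K) (\<lambda>h. U N f y A h - tree_sum M K \<beta> N f y A h))"

definition expands ::
  "nat \<Rightarrow> nat \<Rightarrow> (nat \<Rightarrow> (rvec \<Rightarrow> rvec) \<Rightarrow> rvec \<Rightarrow> (rvec \<Rightarrow> rvec) \<Rightarrow> real \<Rightarrow> rvec) \<Rightarrow> bool" where
  "expands M K U \<longleftrightarrow> (\<exists>\<beta>. expands_with M K \<beta> U)"

lemma finite_TK_order: "finite {\<tau>. \<tau> \<in> TK M \<and> tree_order \<tau> \<le> K}"
  by (rule finite_subset[OF _ finite_trees_of_bounded_order]) auto

lemma expandsI:
  assumes "\<And>N f y vs A h. krylov_linearization N f M y vs A \<Longrightarrow> U N f y A h \<in> Rn N"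
    and "\<And>N f y vs A. krylov_linearization N f M y vs A \<Longrightarrow>
      vanishes_to_order (Suc K) (\<lambda>h. U N f y A h - tree_sum M K \<beta> N f y A h)"
  shows "expands M K U"
  unfolding expands_def expands_with_def
  by (intro exI[of _ \<beta>] allI impI conjI) (erule assms)+

lemma expandsE:
  assumes "expands M K U"
  obtains \<beta> where "expands_with M K \<beta> U"
  using assms unfolding expands_def by (elim exE)

lemma expands_with_in_Rn:
  assumes "expands_with M K \<beta> U" "krylov_linearization N f M y vs A"
  shows "U N f y A h \<in> Rn N"
  using assms(1)[unfolded expands_with_def, rule_format, OF assms(2)] by simp

lemma expands_with_vanishes:
  assumes "expands_with M K \<beta> U" "krylov_linearization N f M y vs A"
  shows "vanishes_to_order (Suc K) (\<lambda>h. U N f y A h - tree_sum M K \<beta> N f y A h)"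
  using assms(1)[unfolded expands_with_def, rule_format, OF assms(2)] by simp

lemma expands_perturb:
  assumes "expands M K V"
    and "\<And>N f y vs A h. krylov_linearization N f M y vs A \<Longrightarrow> U N f y A h \<in> Rn N"
    and "\<And>N f y vs A. krylov_linearization N f M y vs A \<Longrightarrow>
      vanishes_to_order (Suc K) (\<lambda>h. U N f y A h - V N f y A h)"
  shows "expands M K U"
proof -
  obtain \<beta> where \<beta>: "expands_with M K \<beta> V"
    by (rule expandsE[OF assms(1)])
  show ?thesis
  proof (rule expandsI[OF assms(2)])
    fix N f y vs A assume "krylov_linearization N f M y vs A"
    from vanishes_add[OF assms(3)[OF this] expands_with_vanishes[OF \<beta> this]]
    show "vanishes_to_order (Suc K) (\<lambda>h. U N f y A h - tree_sum M K \<beta> N f y A h)" by simp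
  qed
qed

lemma expands_add:
  assumes "expands M K U" "expands M K V"
  shows "expands M K (\<lambda>N f y A h. U N f y A h + V N f y A h)"
proof -
  obtain \<beta> where U: "expands_with M K \<beta> U"
    by (rule expandsE[OF assms(1)])
  obtain \<gamma> where V: "expands_with M K \<gamma> V"
    by (rule expandsE[OF assms(2)])
  have sum: "tree_sum M K (\<lambda>\<tau>. \<beta> \<tau> + \<gamma> \<tau>) N f y A h = tree_sum M K \<beta> N f y A h + tree_sum M K \<gamma> N f y A h"
    for N f y A h
    by (simp add: tree_sum_def distrib_right scaleR_add_left sum.distrib)
  show ?thesis
  proof (rule expandsI)
    fix N f y vs A h assume d: "krylov_linearization N f M y vs A"
    then show "U N f y A h + V N f y A h \<in> Rn N"
      using expands_with_in_Rn[OF U d] expands_with_in_Rn[OF V d] by (intro subspace_add subspace_Rn)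
  next
    fix N f y vs A assume d: "krylov_linearization N f M y vs A"
    from vanishes_add[OF expands_with_vanishes[OF U d] expands_with_vanishes[OF V d]]
    show "vanishes_to_order (Suc K)
        (\<lambda>h. U N f y A h + V N f y A h - tree_sum M K (\<lambda>\<tau>. \<beta> \<tau> + \<gamma> \<tau>) N f y A h)"
      by (simp add: sum algebra_simps)
  qed
qed

lemma expands_scaleR:
  assumes "expands M K U"
  shows "expands M K (\<lambda>N f y A h. c *\<^sub>R U N f y A h)"
proof -
  obtain \<beta> where U: "expands_with M K \<beta> U"
    by (rule expandsE[OF assms(1)])
  have scale: "tree_sum M K (\<lambda>\<tau>. c * \<beta> \<tau>) N f y A h = c *\<^sub>R tree_sum M K \<beta> N f y A h" for N f y A h
    by (simp add: tree_sum_def scaleR_sum_right mult.assoc)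
  show ?thesis
  proof (rule expandsI)
    fix N f y vs A h assume d: "krylov_linearization N f M y vs A"
    show "c *\<^sub>R U N f y A h \<in> Rn N"
      using expands_with_in_Rn[OF U d] by (intro subspace_scale subspace_Rn)
  next
    fix N f y vs A assume d: "krylov_linearization N f M y vs A"
    from vanishes_scaleR[OF expands_with_vanishes[OF U d], of c]
    show "vanishes_to_order (Suc K) (\<lambda>h. c *\<^sub>R U N f y A h - tree_sum M K (\<lambda>\<tau>. c * \<beta> \<tau>) N f y A h)"
      by (simp add: scale scaleR_diff_right)
  qed
qed

lemma expands_diff:
  "expands M K U \<Longrightarrow> expands M K V \<Longrightarrow> expands M K (\<lambda>N f y A h. U N f y A h - V N f y A h)"
  using expands_add[of M K U "\<lambda>N f y A h. - 1 *\<^sub>R V N f y A h"] expands_scaleR[of M K V "-1"] by simp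

lemma expands_zero: "expands M K (\<lambda>N f y A h. 0)"
  by (rule expandsI[where \<beta> = "\<lambda>\<tau>. 0"]) (simp_all add: tree_sum_def subspace_0[OF subspace_Rn])

lemma expands_sum:
  assumes "\<And>x. x \<in> X \<Longrightarrow> expands M K (U x)"
  shows "expands M K (\<lambda>N f y A h. \<Sum>x\<in>X. U x N f y A h)"
  using assms
proof (induction X rule: infinite_finite_induct)
  case (insert x X)
  from expands_add[OF insert.prems insert.IH] insert.hyps insert.prems
  show ?case by simp
qed (simp_all add: expands_zero)

text \<open>
  The tree \<open>\<tau>\<close> is arbitrary; its reduced form is the tree in \<open>TK M\<close> that represents it.
  A tree of order above \<open>K\<close> is absorbed by the error term.
\<close>

lemma expands_elem_diff:
  "expands M K (\<lambda>N f y A h. h ^ tree_order \<tau> *\<^sub>R elem_diff (Rn N) f A y \<tau>)"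
proof (cases "tree_order \<tau> \<le> K")
  case True
  let ?\<beta> = "\<lambda>\<sigma>. if \<sigma> = reduce M \<tau> then 1 else 0"
  show ?thesis
  proof (rule expandsI)
    fix N f y vs A assume d: "krylov_linearization N f M y vs A"
    then interpret krylov_linearization N f M y vs A .
    show "h ^ tree_order \<tau> *\<^sub>R F \<tau> \<in> Rn N" for h
      using F_in_Rn by (intro subspace_scale subspace_Rn)
    have "tree_sum M K ?\<beta> N f y A h = h ^ tree_order \<tau> *\<^sub>R F \<tau>" for h
    proof -
      have "tree_sum M K ?\<beta> N f y A h = (\<Sum>\<sigma> | \<sigma> \<in> TK M \<and> tree_order \<sigma> \<le> K.
          if \<sigma> = reduce M \<tau> then h ^ tree_order \<sigma> *\<^sub>R F \<sigma> else 0)"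
        unfolding tree_sum_def by (rule sum.cong) auto
      also have "\<dots> = h ^ tree_order \<tau> *\<^sub>R F \<tau>"
        using finite_TK_order True reduce_in_TK F_reduce by simp
      finally show ?thesis .
    qed
    then show "vanishes_to_order (Suc K) (\<lambda>h. h ^ tree_order \<tau> *\<^sub>R F \<tau> - tree_sum M K ?\<beta> N f y A h)"
      by simp
  qed
next
  case False
  show ?thesis
  proof (rule expandsI[where \<beta> = "\<lambda>\<sigma>. 0"])
    fix N f y vs A assume d: "krylov_linearization N f M y vs A"
    then interpret krylov_linearization N f M y vs A .
    show "h ^ tree_order \<tau> *\<^sub>R F \<tau> \<in> Rn N" for h
      using F_in_Rn by (intro subspace_scale subspace_Rn)
    show "vanishes_to_order (Suc K) (\<lambda>h. h ^ tree_order \<tau> *\<^sub>R F \<tau> - tree_sum M K (\<lambda>\<sigma>. 0) N f y A h)"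
      using False by (simp add: tree_sum_def vanishes_power)
  qed
qed

text \<open>
  On single trees, applying \<open>h A\<close> is the same as adding a fat root.
\<close>

lemma expands_krylov_operator:
  assumes "expands M K U"
  shows "expands M K (\<lambda>N f y A h. h *\<^sub>R A (U N f y A h))"
proof -
  obtain \<beta> where U: "expands_with M K \<beta> U"
    by (rule expandsE[OF assms])
  let ?V = "\<lambda>N f y A h. \<Sum>\<tau> | \<tau> \<in> TK M \<and> tree_order \<tau> \<le> K.
    \<beta> \<tau> *\<^sub>R (h ^ tree_order (Fat \<tau>) *\<^sub>R elem_diff (Rn N) f A y (Fat \<tau>))"
  show ?thesis
  proof (rule expands_perturb[of M K ?V])
    show "expands M K ?V"
      by (intro expands_sum expands_scaleR expands_elem_diff)
    fix N f y vs A assume d: "krylov_linearization N f M y vs A"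
    then interpret krylov_linearization N f M y vs A .
    interpret A: bounded_linear A by (rule bounded_linear_A)
    show "h *\<^sub>R A (U N f y A h) \<in> Rn N" for h
      by (intro subspace_scale subspace_Rn A_in_Rn)
    have V: "?V N f y A h = h *\<^sub>R A (tree_sum M K \<beta> N f y A h)" for h
      by (simp add: tree_sum_def A.sum A.scaleR scaleR_sum_right mult_ac)
    have "vanishes_to_order (1 + Suc K) (\<lambda>h. h ^ 1 *\<^sub>R A (U N f y A h - tree_sum M K \<beta> N f y A h))"
      by (intro vanishes_power_scaleR vanishes_linear_image[OF expands_with_vanishes[OF U d]] bounded_linear_A)
    then have "vanishes_to_order (Suc K) (\<lambda>h. h ^ 1 *\<^sub>R A (U N f y A h - tree_sum M K \<beta> N f y A h))"
      by (rule vanishes_mono) simp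
    then show "vanishes_to_order (Suc K) (\<lambda>h. h *\<^sub>R A (U N f y A h) - ?V N f y A h)"
      unfolding V by (simp add: A.diff scaleR_diff_right)
  qed
qed

lemma expands_krylov_operator_power:
  assumes "expands M K U"
  shows "expands M K (\<lambda>N f y A h. h ^ i *\<^sub>R (A ^^ i) (U N f y A h))"
proof (induction i)
  case 0
  show ?case using assms by simp
next
  case (Suc i)
  show ?case
  proof (rule expands_perturb[OF expands_krylov_operator[OF Suc.IH]])
    fix N f y vs A assume "krylov_linearization N f M y vs A"
    then interpret krylov_linearization N f M y vs A .
    interpret A: bounded_linear A by (rule bounded_linear_A)
    show "h ^ Suc i *\<^sub>R (A ^^ Suc i) (U N f y A h) \<in> Rn N" for h
      using A_in_Rn subspace_Rn by (simp add: subspace_scale)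
    show "vanishes_to_order (Suc K) (\<lambda>h. h ^ Suc i *\<^sub>R (A ^^ Suc i) (U N f y A h) -
        h *\<^sub>R A (h ^ i *\<^sub>R (A ^^ i) (U N f y A h)))"
      by (simp add: A.scaleR)
  qed
qed

lemma vanishes_tree_sum: "vanishes_to_order 1 (tree_sum M K \<beta> N f y A)"
proof -
  have "vanishes_to_order 1 (\<lambda>h. \<Sum>\<tau> | \<tau> \<in> TK M \<and> tree_order \<tau> \<le> K.
      \<beta> \<tau> *\<^sub>R (h ^ tree_order \<tau> *\<^sub>R elem_diff (Rn N) f A y \<tau>))"
    using tree_order_pos by (intro vanishes_sum vanishes_scaleR vanishes_power) (simp add: Suc_le_eq)
  then show ?thesis
    by (simp add: tree_sum_def[abs_def])
qed

lemma expands_imp_vanishes: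
  assumes "expands M K U" and d: "krylov_linearization N f M y vs A"
  shows "vanishes_to_order 1 (U N f y A)"
proof -
  obtain \<beta> where "expands_with M K \<beta> U"
    by (rule expandsE[OF assms(1)])
  from expands_with_vanishes[OF this d] have "vanishes_to_order 1 (\<lambda>h. U N f y A h - tree_sum M K \<beta> N f y A h)"
    by (rule vanishes_mono) simp
  from vanishes_add[OF this vanishes_tree_sum[of M K \<beta> N f y A]] show ?thesis by simp
qed

lemma funpow_scaled:
  fixes A :: "'a::real_normed_vector \<Rightarrow> 'a"
  assumes "bounded_linear A"
  shows "((\<lambda>x. c *\<^sub>R A x) ^^ i) x = c ^ i *\<^sub>R (A ^^ i) x"
proof (induction i)
  case (Suc i)
  interpret A: bounded_linear A by (rule assms)
  show ?case using Suc by (simp add: A.scaleR)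
qed simp

text \<open>
  After \<open>K + 1\<close> terms, the tail of the series carries a factor \<open>h\<^sup>K\<^sup>+\<^sup>1\<close> in front of a quantity
  that stays bounded.
\<close>

lemma expands_phi_fun:
  assumes "expands M K U"
  shows "expands M K (\<lambda>N f y A h. phi_fun k (\<lambda>x. (g * h) *\<^sub>R A x) (U N f y A h))"
proof -
  let ?V = "\<lambda>N f y A h. \<Sum>i<Suc K. (g ^ i / fact (i + k)) *\<^sub>R (h ^ i *\<^sub>R (A ^^ i) (U N f y A h))"
  show ?thesis
  proof (rule expands_perturb[of M K ?V])
    show "expands M K ?V"
      by (intro expands_sum expands_scaleR expands_krylov_operator_power[OF assms])
    fix N f y vs A assume d: "krylov_linearization N f M y vs A"
    then interpret krylov_linearization N f M y vs A .
    interpret A: bounded_linear A by (rule bounded_linear_A)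
    obtain \<beta> where "expands_with M K \<beta> U"
      by (rule expandsE[OF assms])
    note U = expands_with_in_Rn[OF this d]
    obtain c where c: "c \<ge> 0" "\<And>x. norm (A x) \<le> norm x * c"
      using A.nonneg_bounded by blast
    let ?B = "\<lambda>h x. (g * h) *\<^sub>R A x"
    have B: "bounded_linear (?B h)" "?B h \<in> Rn N \<rightarrow> Rn N"
      "norm (?B h x) \<le> (\<bar>g * h\<bar> * c) * norm x" "0 \<le> \<bar>g * h\<bar> * c" for h x
    proof -
      show "bounded_linear (?B h)"
        by (rule bounded_linear_compose[OF bounded_linear_scaleR_right bounded_linear_A])
      show "?B h \<in> Rn N \<rightarrow> Rn N"
        using A_in_Rn subspace_Rn by (auto simp: subspace_scale)
      show "norm (?B h x) \<le> (\<bar>g * h\<bar> * c) * norm x"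
        using mult_left_mono[OF c(2), of "\<bar>g * h\<bar>" x] by (simp add: mult_ac)
    qed (use c in simp)
    note phi = phi_fun_convergent[OF B U]
    show "phi_fun k (?B h) (U N f y A h) \<in> Rn N" for h by (rule phi)
    let ?R = "\<lambda>h. phi_fun (Suc K + k) (?B h) (U N f y A h)"
    have "vanishes_to_order 0 ?R"
    proof (rule vanishes_to_orderI)
      show "\<forall>\<^sub>F h in at 0. norm (?R h) \<le> exp (\<bar>g\<bar> * c) * \<bar>h\<bar> ^ 0"
        using vanishes_imp_small[OF expands_imp_vanishes[OF assms d] zero_less_one]
          eventually_abs_less[OF zero_less_one]
      proof eventually_elim
        case (elim h)
        have "norm (?R h) \<le> exp (\<bar>g * h\<bar> * c) * norm (U N f y A h)" by (rule phi)
        also have "\<dots> \<le> exp (\<bar>g\<bar> * c) * 1"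
        proof (rule mult_mono)
          have "\<bar>g\<bar> * \<bar>h\<bar> \<le> \<bar>g\<bar>" using elim(2) by (simp add: mult_left_le)
          then show "exp (\<bar>g * h\<bar> * c) \<le> exp (\<bar>g\<bar> * c)"
            using c by (simp add: abs_mult mult_right_mono)
        qed (use elim in auto)
        finally show ?case by simp
      qed
    qed
    from vanishes_linear_image[OF this bounded_linear_funpow[OF bounded_linear_A]]
    have "vanishes_to_order (Suc K + 0) (\<lambda>h. h ^ Suc K *\<^sub>R (g ^ Suc K *\<^sub>R (A ^^ Suc K) (?R h)))"
      by (intro vanishes_power_scaleR vanishes_scaleR)
    moreover have "phi_fun k (?B h) (U N f y A h) - ?V N f y A h =
        h ^ Suc K *\<^sub>R (g ^ Suc K *\<^sub>R (A ^^ Suc K) (?R h))" for h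
    proof -
      have "(\<Sum>i<Suc K. (1 / fact (i + k)) *\<^sub>R (?B h ^^ i) (U N f y A h)) = ?V N f y A h"
        unfolding funpow_scaled[OF bounded_linear_A]
        by (rule sum.cong) (simp_all add: power_mult_distrib)
      moreover have "(?B h ^^ Suc K) (?R h) = h ^ Suc K *\<^sub>R (g ^ Suc K *\<^sub>R (A ^^ Suc K) (?R h))"
        unfolding funpow_scaled[OF bounded_linear_A] by (simp only: power_mult_distrib scaleR_scaleR mult.commute)
      moreover have "phi_fun k (?B h) (U N f y A h) =
          (\<Sum>i<Suc K. (1 / fact (i + k)) *\<^sub>R (?B h ^^ i) (U N f y A h)) + (?B h ^^ Suc K) (?R h)"
        by (rule phi_fun_split[OF B U])
      ultimately show ?thesis by (simp only: add_diff_cancel_left')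
    qed
    ultimately show "vanishes_to_order (Suc K) (\<lambda>h. phi_fun k (?B h) (U N f y A h) - ?V N f y A h)"
      by simp
  qed
qed

lemma expands_psi_fun:
  "expands M K U \<Longrightarrow> expands M K (\<lambda>N f y A h. psi_fun C j (\<lambda>x. (g * h) *\<^sub>R A x) (U N f y A h))"
  unfolding psi_fun_def by (intro expands_sum expands_scaleR expands_phi_fun)

lemma prod_list_map_scaled_powers:
  fixes \<beta> :: "'b \<Rightarrow> real"
  shows "prod_list (map (\<lambda>x. \<beta> x * h ^ n x) xs) = prod_list (map \<beta> xs) * h ^ sum_list (map n xs)"
  by (induction xs) (simp_all add: power_add)

text \<open>
  With \<open>u = T + O(h\<^sup>K\<^sup>+\<^sup>1)\<close> for a tree sum \<open>T = O(h)\<close>, the Lipschitz bound replaces \<open>u\<close> by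
  \<open>T\<close>, and Taylor's theorem replaces \<open>f(y + T)\<close> by the sum of \<open>f\<^sup>(\<^sup>m\<^sup>)(y)(T, \<dots>, T) / m!\<close> over
  \<open>m \<le> K\<close>. Expanding these multilinearly yields one term for each list of trees: up to a scalar
  factor, the elementary differential of the tree that grafts the list onto a meagre root. The
  factor \<open>h\<close> in front accounts for the new root.
\<close>

lemma expands_vector_field:
  assumes "expands M K U"
  shows "expands M K (\<lambda>N f y A h. h *\<^sub>R f (y + U N f y A h))"
proof -
  obtain \<beta> where U: "expands_with M K \<beta> U"
    by (rule expandsE[OF assms])
  let ?X = "{\<tau>. \<tau> \<in> TK M \<and> tree_order \<tau> \<le> K}"
  let ?V = "\<lambda>N f y A h. \<Sum>m<Suc K. \<Sum>xs | set xs \<subseteq> ?X \<and> length xs = m.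
    (prod_list (map \<beta> xs) / fact m) *\<^sub>R
      (h ^ tree_order (Meagre (mset xs)) *\<^sub>R elem_diff (Rn N) f A y (Meagre (mset xs)))"
  show ?thesis
  proof (rule expands_perturb[of M K ?V])
    show "expands M K ?V"
      by (intro expands_sum expands_scaleR expands_elem_diff)
    fix N f y vs A assume d: "krylov_linearization N f M y vs A"
    then interpret krylov_linearization N f M y vs A .
    let ?U = "U N f y A" and ?T = "tree_sum M K \<beta> N f y A"
    note U = expands_with_in_Rn[OF U d] expands_with_vanishes[OF U d]
    have T: "?T h \<in> Rn N" for h
      unfolding tree_sum_def using F_in_Rn by (intro subspace_sum subspace_scale subspace_Rn)
    have "y + ?U h \<in> Rn N" for h
      using y U(1) by (intro subspace_add subspace_Rn)
    then show "h *\<^sub>R f (y + ?U h) \<in> Rn N" for h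
      using maps_Rn by (intro subspace_scale subspace_Rn) auto
    let ?P = "\<lambda>h. \<Sum>m<Suc K. (1 / fact m) *\<^sub>R nderiv (Rn N) f (replicate m (?T h)) y"
    have V: "?V N f y A h = h *\<^sub>R ?P h" for h
    proof -
      have "nderiv (Rn N) f (replicate m (?T h)) y = (\<Sum>xs | set xs \<subseteq> ?X \<and> length xs = m.
          (prod_list (map \<beta> xs) * h ^ sum_list (map tree_order xs)) *\<^sub>R F (Meagre (mset xs)))" for m
        unfolding tree_sum_def F_Meagre_mset prod_list_map_scaled_powers[symmetric]
        by (rule nderiv_replicate_expansion) (use finite_TK_order F_in_Rn y in auto)
      moreover have "tree_order (Meagre (mset xs)) = Suc (sum_list (map tree_order xs))" for xs
        by (simp add: sum_mset_sum_list[symmetric])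
      ultimately show ?thesis
        by (simp add: scaleR_sum_right mult_ac del: sum.lessThan_Suc elem_diff.simps tree_order.simps)
    qed
    have T1: "vanishes_to_order 1 ?T" by (rule vanishes_tree_sum)
    have U1: "vanishes_to_order 1 ?U" by (rule expands_imp_vanishes[OF assms d])
    have "vanishes_to_order (Suc K) (\<lambda>h. f (y + ?U h) - f (y + ?T h))"
    proof -
      obtain L e where L: "e > 0" "\<And>u w. u \<in> Rn N \<Longrightarrow> w \<in> Rn N \<Longrightarrow> norm u < e \<Longrightarrow> norm w < e \<Longrightarrow>
          norm (f (y + u) - f (y + w)) \<le> L * norm (u - w)"
        using locally_lipschitz[OF y] by blast
      obtain B where "\<forall>\<^sub>F h in at 0. norm (?U h - ?T h) \<le> B * \<bar>h\<bar> ^ Suc K"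
        using U(2) by (auto simp: vanishes_to_order_def)
      then have "\<forall>\<^sub>F h in at 0. norm (f (y + ?U h) - f (y + ?T h)) \<le> (\<bar>L\<bar> * B) * \<bar>h\<bar> ^ Suc K"
        using vanishes_imp_small[OF T1 L(1)] vanishes_imp_small[OF U1 L(1)]
      proof eventually_elim
        case (elim h)
        have "norm (f (y + ?U h) - f (y + ?T h)) \<le> L * norm (?U h - ?T h)"
          using L(2) U(1) T elim by blast
        also have "\<dots> \<le> \<bar>L\<bar> * norm (?U h - ?T h)" by (intro mult_right_mono) auto
        also have "\<dots> \<le> \<bar>L\<bar> * (B * \<bar>h\<bar> ^ Suc K)" using elim(1) by (intro mult_left_mono) auto
        finally show ?case by (simp only: mult.assoc)
      qed
      then show ?thesis by (rule vanishes_to_orderI)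
    qed
    moreover have "vanishes_to_order (Suc K) (\<lambda>h. f (y + ?T h) - ?P h)"
    proof -
      obtain L e where L: "e > 0" "\<And>u. u \<in> Rn N \<Longrightarrow> norm u < e \<Longrightarrow>
          norm (f (y + u) - (\<Sum>m<Suc K. (1 / fact m) *\<^sub>R nderiv (Rn N) f (replicate m u) y)) \<le> L * norm u ^ Suc K"
        using taylor_approximation[OF y, of "Suc K"] by blast
      obtain B where B: "\<forall>\<^sub>F h in at 0. norm (?T h) \<le> B * \<bar>h\<bar> ^ 1"
        using T1 by (auto simp: vanishes_to_order_def)
      then have "\<forall>\<^sub>F h in at 0. norm (f (y + ?T h) - ?P h) \<le> (\<bar>L\<bar> * B ^ Suc K) * \<bar>h\<bar> ^ Suc K"
        using vanishes_imp_small[OF T1 L(1)]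
      proof eventually_elim
        case (elim h)
        have "norm (f (y + ?T h) - ?P h) \<le> L * norm (?T h) ^ Suc K"
          using L(2)[OF T elim(2)] .
        also have "\<dots> \<le> \<bar>L\<bar> * norm (?T h) ^ Suc K" by (intro mult_right_mono) auto
        also have "\<dots> \<le> \<bar>L\<bar> * (B * \<bar>h\<bar> ^ 1) ^ Suc K"
          by (intro mult_left_mono power_mono elim(1)) auto
        finally show ?case by (simp only: mult.assoc power_mult_distrib power_one_right)
      qed
      then show ?thesis by (rule vanishes_to_orderI)
    qed
    ultimately have "vanishes_to_order (Suc K) (\<lambda>h. (f (y + ?U h) - f (y + ?T h)) + (f (y + ?T h) - ?P h))"
      by (rule vanishes_add)
    then have "vanishes_to_order (Suc K) (\<lambda>h. f (y + ?U h) - ?P h)"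
      by (simp only: diff_add_cancel add_diff_eq)
    from vanishes_power_scaleR[OF this, of 1]
    have "vanishes_to_order (Suc K) (\<lambda>h. h ^ 1 *\<^sub>R (f (y + ?U h) - ?P h))"
      by (rule vanishes_mono) simp
    then show "vanishes_to_order (Suc K) (\<lambda>h. h *\<^sub>R f (y + ?U h) - ?V N f y A h)"
      unfolding V by (simp only: scaleR_diff_right power_one_right)
  qed
qed

section \<open>Tree expansions of the stages and of the step\<close>

lemma expands_remainder:
  assumes "expands M K (\<lambda>N f y A h. Y f A y h - y)"
  shows "expands M K (\<lambda>N f y A h. h *\<^sub>R remainder f A y (Y f A y h))"
proof -
  have 0: "expands M K (\<lambda>N f y A h. h *\<^sub>R f y)"
    using expands_vector_field[OF expands_zero[of M K]] by simp
  have "expands M K (\<lambda>N f y A h. h *\<^sub>R f (Y f A y h) - h *\<^sub>R f y - h *\<^sub>R A (Y f A y h - y))"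
    using expands_diff[OF expands_diff[OF expands_vector_field[OF assms] 0] expands_krylov_operator[OF assms]]
    by simp
  then show ?thesis by (simp add: remainder_def scaleR_diff_right)
qed

lemma expands_fdiff:
  assumes "\<And>k. k \<le> i + j \<Longrightarrow> expands M K (\<lambda>N f y A h. h *\<^sub>R u k f A y h)"
  shows "expands M K (\<lambda>N f y A h. h *\<^sub>R fdiff (\<lambda>k. u k f A y h) j i)"
  using assms
proof (induction j arbitrary: i)
  case (Suc j)
  have "expands M K (\<lambda>N f y A h. h *\<^sub>R fdiff (\<lambda>k. u k f A y h) j (Suc i) - h *\<^sub>R fdiff (\<lambda>k. u k f A y h) j i)"
    by (intro expands_diff Suc.IH Suc.prems) auto
  then show ?case by (simp add: scaleR_diff_right)
qed simp

text \<open>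
  The stages and the final step have this common form.
\<close>

lemma expands_increment:
  assumes "\<And>k. k < n \<Longrightarrow> expands M K (\<lambda>N f y A h. stage C f A y h k - y)"
  shows "expands M K (\<lambda>N f y A h.
    c 1 *\<^sub>R psi_fun C 1 (\<lambda>x. (g 1 * h) *\<^sub>R A x) (h *\<^sub>R f y)
    + (\<Sum>j=2..n. c j *\<^sub>R psi_fun C j (\<lambda>x. (g j * h) *\<^sub>R A x)
        (h *\<^sub>R fdiff (\<lambda>k. remainder f A y (stage C f A y h k)) (j - 1) 0)))"
proof (intro expands_add expands_sum expands_scaleR expands_psi_fun)
  show "expands M K (\<lambda>N f y A h. h *\<^sub>R f y)"
    using expands_vector_field[OF expands_zero[of M K]] by simp
  fix j assume "j \<in> {2..n}"
  then show "expands M K (\<lambda>N f y A h. h *\<^sub>R fdiff (\<lambda>k. remainder f A y (stage C f A y h k)) (j - 1) 0)"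
    by (intro expands_fdiff expands_remainder assms) auto
qed

lemma expands_stage: "expands M K (\<lambda>N f y A h. stage C f A y h i - y)"
proof (induction i rule: less_induct)
  case (less i)
  show ?case
  proof (cases i)
    case 0
    then show ?thesis using expands_zero by simp
  next
    case (Suc k)
    then show ?thesis
      using expands_increment[of "Suc k" M K C "coef_a C (Suc k)" "coef_g C (Suc k)"] less
      by (simp add: add.assoc del: sum.cl_ivl_Suc)
  qed
qed

lemma expands_epirk_step: "expands M K (\<lambda>N f y A h. epirk_step C f A y h - y)"
  using expands_increment[of "stages C" M K C "coef_b C" "coef_g C (stages C)"] expands_stage
  by (simp add: epirk_step_def add.assoc)

section \<open>Coefficients independent of the truncation order\<close>

lemma tree_sum_by_order:
  "tree_sum M K \<beta> N f y A h =
    (\<Sum>j\<le>K. h ^ j *\<^sub>R (\<Sum>\<tau> | \<tau> \<in> TK M \<and> tree_order \<tau> = j. \<beta> \<tau> *\<^sub>R elem_diff (Rn N) f A y \<tau>))"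
proof -
  let ?X = "{\<tau>. \<tau> \<in> TK M \<and> tree_order \<tau> \<le> K}"
  have "tree_sum M K \<beta> N f y A h = (\<Sum>j\<le>K. \<Sum>\<tau> | \<tau> \<in> ?X \<and> tree_order \<tau> = j.
      (\<beta> \<tau> * h ^ tree_order \<tau>) *\<^sub>R elem_diff (Rn N) f A y \<tau>)"
    unfolding tree_sum_def by (rule sum.group[symmetric]) (use finite_TK_order in auto)
  also have "\<dots> = (\<Sum>j\<le>K. h ^ j *\<^sub>R (\<Sum>\<tau> | \<tau> \<in> TK M \<and> tree_order \<tau> = j. \<beta> \<tau> *\<^sub>R elem_diff (Rn N) f A y \<tau>))"
    unfolding scaleR_sum_right by (intro sum.cong) (auto simp: mult.commute)
  finally show ?thesis .
qed

text \<open>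
  Only powers of \<open>h\<close> above \<open>k\<close> are lost.
\<close>

lemma tree_sum_truncate:
  assumes "k \<le> K"
  shows "vanishes_to_order (Suc k) (\<lambda>h. tree_sum M K \<beta> N f y A h - tree_sum M k \<beta> N f y A h)"
proof -
  let ?D = "\<lambda>j. \<Sum>\<tau> | \<tau> \<in> TK M \<and> tree_order \<tau> = j. \<beta> \<tau> *\<^sub>R elem_diff (Rn N) f A y \<tau>"
  have "tree_sum M K \<beta> N f y A h - tree_sum M k \<beta> N f y A h = (\<Sum>j\<in>{..K} - {..k}. h ^ j *\<^sub>R ?D j)" for h
    unfolding tree_sum_by_order using assms by (subst sum_diff) auto
  moreover have "vanishes_to_order (Suc k) (\<lambda>h. \<Sum>j\<in>{..K} - {..k}. h ^ j *\<^sub>R ?D j)"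
    by (intro vanishes_sum vanishes_power) auto
  ultimately show ?thesis by simp
qed

theorem theorem4p5:
  fixes C :: epirk and M :: nat
  assumes "stages C \<ge> 1" and "M \<ge> 1"
  shows "\<exists>a :: tw_tree \<Rightarrow> real.
    \<forall>(N :: nat) (f :: rvec \<Rightarrow> rvec) (y :: rvec) (vs :: rvec list) (A :: rvec \<Rightarrow> rvec) (K :: nat).
      f \<in> Rn N \<rightarrow> Rn N \<longrightarrow> smooth_on (Rn N) f \<longrightarrow> y \<in> Rn N \<longrightarrow>
      orthonormal vs \<longrightarrow> span (set vs) = krylov_space (Rn N) f M y \<longrightarrow>
      A = krylov_approx vs (deriv_on (Rn N) f y) \<longrightarrow> K \<ge> 1 \<longrightarrow>
      (\<lambda>h. norm (epirk_step C f A y h -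
              (y + (\<Sum>\<tau> | \<tau> \<in> TK M \<and> tree_order \<tau> \<le> K.
                 (a \<tau> * h ^ tree_order \<tau> / real (symmetry \<tau>)) *\<^sub>R
                   elem_diff (Rn N) f A y \<tau>))))
        \<in> O[at 0](\<lambda>h. h ^ (K + 1))"
proof -
  let ?U = "\<lambda>f y A h. epirk_step C f A y h - y"
  have "\<exists>\<beta>. expands_with M K \<beta> (\<lambda>N. ?U)" for K
    using expands_epirk_step[of M K C] by (simp add: expands_def)
  then obtain b where "\<forall>K. expands_with M K (b K) (\<lambda>N. ?U)"
    using choice[of "\<lambda>K \<beta>. expands_with M K \<beta> (\<lambda>N. ?U)"] by blast
  note b = expands_with_vanishes[OF this[rule_format]]
  define \<alpha> where "\<alpha> \<tau> = b (tree_order \<tau>) \<tau>" for \<tau>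
  \<comment> \<open>\<open>symmetry\<close> cancels the denominator in the statement\<close>
  show ?thesis
  proof (rule exI[of _ "\<lambda>\<tau>. \<alpha> \<tau> * real (symmetry \<tau>)"], intro allI impI)
    fix N f y vs A and K :: nat
    assume "f \<in> Rn N \<rightarrow> Rn N" "smooth_on (Rn N) f" "y \<in> Rn N" "orthonormal vs"
      "span (set vs) = krylov_space (Rn N) f M y" "A = krylov_approx vs (deriv_on (Rn N) f y)"
    then have d: "krylov_linearization N f M y vs A"
      by unfold_locales
    let ?D = "\<lambda>\<beta> j. \<Sum>\<tau> | \<tau> \<in> TK M \<and> tree_order \<tau> = j. \<beta> \<tau> *\<^sub>R elem_diff (Rn N) f A y \<tau>"
    \<comment> \<open>both expansions are valid to order \<open>k\<close>, so their coefficients of \<open>h\<^sup>k\<close> agree\<close>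
    have "?D (b K) k = ?D \<alpha> k" if "k \<le> K" for k
    proof -
      have "vanishes_to_order (Suc k) (\<lambda>h. ?U f y A h - tree_sum M K (b K) N f y A h)"
        by (rule vanishes_mono[OF b[OF d]]) (use that in simp)
      from vanishes_add[OF this tree_sum_truncate[OF that, of M "b K" N f y A]]
      have "vanishes_to_order (Suc k) (\<lambda>h. ?U f y A h - tree_sum M k (b K) N f y A h)"
        by (simp only: diff_add_cancel add_diff_eq)
      from vanishes_diff[OF b[OF d, of k] this]
      have "vanishes_to_order (Suc k) (\<lambda>h. tree_sum M k (b K) N f y A h - tree_sum M k (b k) N f y A h)"
        by simp
      then have "vanishes_to_order (Suc k) (\<lambda>h. \<Sum>j\<le>k. h ^ j *\<^sub>R (?D (b K) j - ?D (b k) j))"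
        by (simp add: tree_sum_by_order scaleR_diff_right sum_subtractf)
      from polynomial_coefficients_vanish[OF this, of k]
      have "?D (b K) k = ?D (b k) k" by simp
      also have "\<dots> = ?D \<alpha> k" by (rule sum.cong) (auto simp: \<alpha>_def)
      finally show ?thesis .
    qed
    then have "tree_sum M K (b K) N f y A h = tree_sum M K \<alpha> N f y A h" for h
      by (simp add: tree_sum_by_order)
    then have "vanishes_to_order (K + 1) (\<lambda>h. ?U f y A h - tree_sum M K \<alpha> N f y A h)"
      using b[OF d, of K] by simp
    note vanishes_imp_bigo[OF this]
    moreover have "?U f y A h - tree_sum M K \<alpha> N f y A h = epirk_step C f A y h -
        (y + (\<Sum>\<tau> | \<tau> \<in> TK M \<and> tree_order \<tau> \<le> K.
          (\<alpha> \<tau> * real (symmetry \<tau>) * h ^ tree_order \<tau> / real (symmetry \<tau>)) *\<^sub>R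
            elem_diff (Rn N) f A y \<tau>))" for h
    proof -
      have "\<alpha> \<tau> * real (symmetry \<tau>) * h ^ tree_order \<tau> / real (symmetry \<tau>) = \<alpha> \<tau> * h ^ tree_order \<tau>" for \<tau>
        using symmetry_pos[of \<tau>] by simp
      then show ?thesis by (simp only: tree_sum_def diff_diff_eq)
    qed
    ultimately show "(\<lambda>h. norm (epirk_step C f A y h -
              (y + (\<Sum>\<tau> | \<tau> \<in> TK M \<and> tree_order \<tau> \<le> K.
                 (\<alpha> \<tau> * real (symmetry \<tau>) * h ^ tree_order \<tau> / real (symmetry \<tau>)) *\<^sub>R
                   elem_diff (Rn N) f A y \<tau>))))
        \<in> O[at 0](\<lambda>h. h ^ (K + 1))"
      by (simp only:)
  qed
qed

end
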